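(* Let $\mathbb{D}$ be the open unit disk in $\mathbb{C}$, let $\mathrm{Aut}(\mathbb{D})$ be its analytic automorphism group, and for $\xi\in\mathbb{R}$, $u\in\mathbb{D}$ let $f_{\xi,u}(z)=\mathrm{e}^{\mathbf{i}\xi}\frac{z-u}{1-\overline{u}z}$. Let $d_{H^\infty}(\varphi,\psi)=\sup_{z\in\mathbb{D}}|\varphi(z)-\psi(z)|$ for $\varphi,\psi\in\mathrm{Aut}(\mathbb{D})$, and let $\rho(u,v)=\left|\frac{u-v}{1-\bar{u}v}\right|$ for $u,v\in\mathbb{D}$. Given any $\xi,\eta\in\mathbb{R}$ and any $u,v\in\mathbb{D}$, let \[ \lambda=\mathrm{e}^{\mathbf{i}(\eta-\xi)}\cdot\frac{1-\bar{u}v}{1-u\bar{v}}. \] Then: (1) if $|\lambda+1|\leq 2\rho(u,v)$, then $d_{H^\infty}(f_{\xi,u},f_{\eta,v})=2$; (2) if $|\lambda+1|>2\rho(u,v)$, then \[ d_{H^\infty}(f_{\xi,u},f_{\eta,v})=\left|\left(1-2\rho^2(u,v)-2\mathbf{i}\rho(u,v)\sqrt{1-\rho^2(u,v)}\right)-\left(\mathrm{Re}\,\lambda+\mathbf{i}|\mathrm{Im}\,\lambda|\right)\right|. \] Furthermore, the geometric structure $F(f_{\xi,u},(s,h))$ on $\mathrm{Aut}(\mathbb{D})$ induced by $d_{H^\infty}$ (with $s\in\mathbb{R}$, $h\in\mathbb{C}$) is a non-Riemannian reversible almost regular Finsler structure, whose explicit formula is \[ F(f_{\xi,u},(s,h))=\frac{2|h|+\left|2\,\mathrm{Im}(\bar{u}h)-s(1-|u|^2)\right|}{1-|u|^2}.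 \] Moreover, the metric space $(\mathrm{Aut}(\mathbb{D}),d_{H^\infty})$ is not a geodetic space.
   Context: Every $\varphi\in\mathrm{Aut}(\mathbb{D})$ (the group, under composition, of biholomorphic self-maps of $\mathbb{D}$) has the form $f_{\xi,u}$ for some $\xi\in\mathbb{R}$ and $u\in\mathbb{D}$. The correspondence $f_{\xi,u}\mapsto(\xi,u)$ induces local coordinates making $M=\mathrm{Aut}(\mathbb{D})$ a smooth $3$-dimensional real manifold; in these coordinates a tangent vector at $f_{\xi,u}$ is written as a pair $(s,h)\in\mathbb{R}\times\mathbb{C}\cong\mathbb{R}^3$. Induced geometric structure: for $(s,h)\in\mathbb{R}\times\mathbb{C}$, \[ F(f_{\xi,u},(s,h))=\lim_{\Delta t\to 0^+}\frac{d_{H^\infty}(f_{\xi,u},f_{\xi+s\Delta t,\,u+h\Delta t})}{\Delta t}. \] Finsler structures: for a smooth manifold $M$ with tangent bundle $TM$ (elements written $(x,y)$ with $y\in T_xM$), let $\widetilde{TM}=TM\setminus 0$ be the slit tangent bundle. A function $F=F(x,y)$ on $TM$ is a Finsler structure if (i) (regularity) $F$ is $C^\infty$ on $\widetilde{TM}$; (ii) (positive homogeneity) $F(x,ty)=tF(x,y)$ for $t\in\mathbb{R}^+$ and $(x,y)\in\widetilde{TM}$; (iii) (strong convexity) the fundamental tensor $g_{ij}(x,y)=\frac12\frac{\partial^2F^2}{\partial y^i\partial y^j}$ is positive definite on $\widetilde{TM}$. More generally, if $\widetilde{TM}$ is replaced by $TM\setminus E_0$, where $E_0$ is a proper sub-bundle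 of $TM$, then $F$ is called an almost regular Finsler structure. $F$ is reversible if $F(x,y)=F(x,-y)$ for all $(x,y)\in\widetilde{TM}$. $F$ is Riemannian if $F(x,y)=\sqrt{g_{ij}(x)y^iy^j}$ for a Riemannian metric $g$, i.e. if its fundamental tensor is independent of the tangent vector $y$ (equivalently, its Cartan tensor, built from the third derivatives $(F^2)_{y^iy^jy^k}$, vanishes identically); it is non-Riemannian otherwise. Geodetic (geodesic) space: for a metric space $(X,d)$ and $L\in\mathbb{R}^+$, an $L$-geodesic is an isometric embedding $\gamma:[0,L]\to X$, i.e. $d(\gamma(t_1),\gamma(t_2))=|t_2-t_1|$ for all $t_1,t_2\in[0,L]$. $(X,d)$ is a geodetic (geodesic) space if for any $x,x'\in X$ there is a geodesic with starting point $x$ and ending point $x'$.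
   Formalization: Almost regularity as defined is false (the fundamental tensor has rank 2); proved instead: F is smooth off a finite union of proper sub-bundles, its fundamental tensor there is positive off one line, and F is positive off zero, positively homogeneous and subadditive. *)

theory Defs
  imports "HOL-Complex_Analysis.Complex_Analysis"
begin

abbreviation unit_disc :: "complex set" where
  "unit_disc \<equiv> ball 0 1"

text \<open>Self-maps of the disc are represented by extensional functions (\<^term>\<open>undefined\<close>
  off the disc), so that equality of automorphisms is equality in HOL.\<close>

definition Aut_disc :: "(complex \<Rightarrow> complex) set" where
  "Aut_disc = {\<phi> \<in> extensional unit_disc.
      \<phi> holomorphic_on unit_disc \<and> bij_betw \<phi> unit_disc unit_disc \<and>
      inv_into unit_disc \<phi> holomorphic_on unit_disc}"

definition disc_aut :: "real \<Rightarrow> complex \<Rightarrow> complex \<Rightarrow> complex" where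
  "disc_aut \<xi> u = restrict (Moebius_function \<xi> u) unit_disc"

definition dist_Hinf :: "(complex \<Rightarrow> complex) \<Rightarrow> (complex \<Rightarrow> complex) \<Rightarrow> real" where
  "dist_Hinf \<phi> \<psi> = (SUP z\<in>unit_disc. cmod (\<phi> z - \<psi> z))"

definition pseudo_dist :: "complex \<Rightarrow> complex \<Rightarrow> real" where
  "pseudo_dist u v = cmod ((u - v) / (1 - cnj u * v))"

definition geodesic :: "real \<Rightarrow> 'a set \<Rightarrow> ('a \<Rightarrow> 'a \<Rightarrow> real) \<Rightarrow> (real \<Rightarrow> 'a) \<Rightarrow> bool" where
  "geodesic L X d \<gamma> \<longleftrightarrow> \<gamma> \<in> {0..L} \<rightarrow> X \<and>
     (\<forall>t1\<in>{0..L}. \<forall>t2\<in>{0..L}. d (\<gamma> t1) (\<gamma> t2) = \<bar>t2 - t1\<bar>)"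

text \<open>\<open>L = 0\<close> is allowed: otherwise the case \<open>x = x'\<close> would prevent every nonempty space from
  being geodetic.\<close>

definition geodetic_space :: "'a set \<Rightarrow> ('a \<Rightarrow> 'a \<Rightarrow> real) \<Rightarrow> bool" where
  "geodetic_space X d \<longleftrightarrow>
     (\<forall>x\<in>X. \<forall>x'\<in>X. \<exists>L\<ge>0. \<exists>\<gamma>. geodesic L X d \<gamma> \<and> \<gamma> 0 = x \<and> \<gamma> L = x')"

text \<open>\<open>C\<^sup>k\<close> and \<open>C\<^sup>\<infinity>\<close> functions on an open subset of a finite-dimensional space.\<close>

primrec Ck_on :: "nat \<Rightarrow> ('a::euclidean_space \<Rightarrow> 'b::real_normed_vector) \<Rightarrow> 'a set \<Rightarrow> bool" where
  "Ck_on 0 f S \<longleftrightarrow> continuous_on S f"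
| "Ck_on (Suc k) f S \<longleftrightarrow> (\<forall>x\<in>S. f differentiable (at x)) \<and>
     (\<forall>v. Ck_on k (\<lambda>x. frechet_derivative f (at x) v) S)"

definition smooth_on :: "('a::euclidean_space \<Rightarrow> 'b::real_normed_vector) \<Rightarrow> 'a set \<Rightarrow> bool" where
  "smooth_on f S \<longleftrightarrow> (\<forall>k. Ck_on k f S)"

text \<open>The map \<open>(\<xi>, u) \<mapsto> disc_aut \<xi> u\<close> on \<open>\<real> \<times> \<D>\<close> is a covering of \<open>Aut(\<D>)\<close> whose local inverses
  are the charts; their transition maps are translations of \<open>\<xi>\<close> by multiples of \<open>2\<pi>\<close>, which act
  trivially on the tangent coordinates \<open>(s, h)\<close>. Hence the tangent space at every \<open>\<phi>\<close> is
  canonically \<open>\<real> \<times> \<complex>\<close>, and an object on \<open>Aut(\<D>)\<close> or its tangent bundle is smooth iff its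
  pullback to \<open>\<real> \<times> \<D>\<close>, respectively \<open>(\<real> \<times> \<D>) \<times> (\<real> \<times> \<complex>)\<close>, is.\<close>

type_synonym tangent = "real \<times> complex"
type_synonym structure_on_TAut = "(complex \<Rightarrow> complex) \<Rightarrow> tangent \<Rightarrow> real"

definition disc_coords :: "(complex \<Rightarrow> complex) \<Rightarrow> real \<times> complex" where
  "disc_coords \<phi> = (SOME p. snd p \<in> unit_disc \<and> \<phi> = disc_aut (fst p) (snd p))"

definition induced_structure :: structure_on_TAut where
  "induced_structure \<phi> y = (case disc_coords \<phi> of (\<xi>, u) \<Rightarrow> case y of (s, h) \<Rightarrow>
     Lim (at_right 0)
       (\<lambda>t. dist_Hinf (disc_aut \<xi> u) (disc_aut (\<xi> + s * t) (u + h * of_real t)) / t))"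

text \<open>A proper sub-bundle of the tangent bundle: a smooth family of subspaces of constant
  dimension \<open>k < 3\<close>, given locally as the span of \<open>k\<close> smooth vector fields.\<close>

definition proper_subbundle :: "((complex \<Rightarrow> complex) \<Rightarrow> tangent set) \<Rightarrow> bool" where
  "proper_subbundle E \<longleftrightarrow> (\<exists>k<3.
     (\<forall>\<phi>\<in>Aut_disc. subspace (E \<phi>) \<and> dim (E \<phi>) = k) \<and>
     (\<forall>p \<in> UNIV \<times> unit_disc. \<exists>U b. open U \<and> p \<in> U \<and> U \<subseteq> UNIV \<times> unit_disc \<and>
        (\<forall>i<k. smooth_on (b i :: real \<times> complex \<Rightarrow> tangent) U) \<and>
        (\<forall>(\<xi>, u)\<in>U. E (disc_aut \<xi> u) = span ((\<lambda>i::nat. b i (\<xi>, u)) ` {..<k}))))"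

text \<open>The fundamental tensor \<open>g(x, y) = \<Sum> g\<^sub>i\<^sub>j(x, y) dy\<^sup>i dy\<^sup>j\<close> as a bilinear form in \<open>v\<close>, \<open>w\<close>,
  where \<open>g\<^sub>i\<^sub>j\<close> is one half of the second partial derivative of \<open>F\<^sup>2\<close> in the fibre.\<close>

definition fundamental_tensor ::
    "structure_on_TAut \<Rightarrow> (complex \<Rightarrow> complex) \<Rightarrow> tangent \<Rightarrow> tangent \<Rightarrow> tangent \<Rightarrow> real" where
  "fundamental_tensor F \<phi> y v w =
     frechet_derivative
       (\<lambda>y'. frechet_derivative (\<lambda>y''. (F \<phi> y'')\<^sup>2) (at y') v) (at y) w / 2"

text \<open>Almost regular Finsler structures, with the exceptional set and the convexity requirement
  relaxed. Where \<open>h \<noteq> 0\<close> and \<open>w = 2 Im (cnj u * h) - s (1 - |u|\<^sup>2) \<noteq> 0\<close>, the structure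
  \<open>F = (2 |h| + |w|) / (1 - |u|\<^sup>2)\<close> is locally constant along the direction in which \<open>h\<close> moves
  radially and \<open>|w|\<close> changes at \<open>-2\<close> times the rate of \<open>|h|\<close>; so no nonzero tangent vector has a
  positive definite fundamental tensor. Moreover \<open>F\<close> is singular exactly on the union of the line
  bundle \<open>h = 0\<close> and the plane bundle \<open>w = 0\<close>, which is contained in no proper vector sub-bundle.
  Therefore, here:

  \<^item> the exceptional set is a union of finitely many proper sub-bundles;
  \<^item> at every other \<open>(x, y)\<close> the fundamental tensor is positive on all directions except possibly
    those of one line (hence positive semidefinite of rank at least two);
  \<^item> in addition every \<open>F(x, \<cdot>)\<close> is positive off \<open>0\<close> and subadditive, which strong convexity
    would have implied.\<close>

definition almost_regular_weak_Finsler :: "structure_on_TAut \<Rightarrow> bool" where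
  "almost_regular_weak_Finsler F \<longleftrightarrow>
     (\<exists>\<E>. finite \<E> \<and> \<E> \<noteq> {} \<and> (\<forall>E\<in>\<E>. proper_subbundle E) \<and>
        smooth_on (\<lambda>((\<xi>, u), y). F (disc_aut \<xi> u) y)
          {((\<xi>, u), y). u \<in> unit_disc \<and> (\<forall>E\<in>\<E>. y \<notin> E (disc_aut \<xi> u))} \<and>
        (\<forall>\<phi>\<in>Aut_disc. \<forall>y. (\<forall>E\<in>\<E>. y \<notin> E \<phi>) \<longrightarrow>
           (\<exists>n. \<forall>v. v \<notin> span {n} \<longrightarrow> fundamental_tensor F \<phi> y v v > 0))) \<and>
     (\<forall>\<phi>\<in>Aut_disc. \<forall>t>0. \<forall>y. F \<phi> (t *\<^sub>R y) = t * F \<phi> y) \<and>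
     (\<forall>\<phi>\<in>Aut_disc. \<forall>y. y \<noteq> 0 \<longrightarrow> F \<phi> y > 0) \<and>
     (\<forall>\<phi>\<in>Aut_disc. \<forall>y y'. F \<phi> (y + y') \<le> F \<phi> y + F \<phi> y')"

definition reversible :: "structure_on_TAut \<Rightarrow> bool" where
  "reversible F \<longleftrightarrow> (\<forall>\<phi>\<in>Aut_disc. \<forall>y. y \<noteq> 0 \<longrightarrow> F \<phi> y = F \<phi> (- y))"

definition riemannian_metric ::
    "((complex \<Rightarrow> complex) \<Rightarrow> tangent \<Rightarrow> tangent \<Rightarrow> real) \<Rightarrow> bool" where
  "riemannian_metric g \<longleftrightarrow>
     (\<forall>\<phi>\<in>Aut_disc. bilinear (g \<phi>) \<and> (\<forall>v w. g \<phi> v w = g \<phi> w v) \<and> (\<forall>v. v \<noteq> 0 \<longrightarrow> g \<phi> v v > 0)) \<and>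
     (\<forall>v w. smooth_on (\<lambda>(\<xi>, u). g (disc_aut \<xi> u) v w) (UNIV \<times> unit_disc))"

definition riemannian :: "structure_on_TAut \<Rightarrow> bool" where
  "riemannian F \<longleftrightarrow>
     (\<exists>g. riemannian_metric g \<and> (\<forall>\<phi>\<in>Aut_disc. \<forall>y. F \<phi> y = sqrt (g \<phi> y y)))"

end

theory Submission
  imports Defs
begin

text \<open>By the maximum principle the distance of two automorphisms is the maximum over the unit circle
  of \<open>|f\<^sub>\<xi>\<^sub>,\<^sub>u - f\<^sub>\<eta>\<^sub>,\<^sub>v|\<close>. There \<open>f\<^sub>\<xi>\<^sub>,\<^sub>u(z)\<close> has modulus \<open>1\<close>, and the quotient of the two values is
  \<open>\<mu>\<^sup>2 cnj b / b\<close>, where \<open>\<mu>\<^sup>2 = \<lambda>\<close> and \<open>b\<close> runs through the circle of radius \<open>\<rho>(u, v)\<close> about \<open>1\<close>. So the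
  distance is the maximum of \<open>2 |Im (cnj \<mu> b)| / |b|\<close>, twice the sine of the angle between \<open>\<mu>\<close> and \<open>b\<close>.
  It is \<open>2\<close> if the line \<open>\<real> \<i> \<mu>\<close> meets the circle, and is otherwise attained at a point where the line
  through \<open>0\<close> is tangent to the circle, which gives \<open>2 (\<rho> Re \<mu> + sqrt (1 - \<rho>\<^sup>2) |Im \<mu>|)\<close>. The induced
  structure is the derivative of this expression.\<close>

section \<open>The distance of two automorphisms\<close>

lemma one_minus_cnj_mult_nonzero:
  assumes "cmod w < 1" "cmod z \<le> 1"
  shows "1 - cnj w * z \<noteq> 0"
proof
  assume "1 - cnj w * z = 0"
  then have "cmod (cnj w * z) = 1"
    by simp
  moreover have "cmod (cnj w * z) \<le> cmod w * 1"
    unfolding norm_mult complex_mod_cnj using assms by (intro mult_left_mono) auto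
  ultimately show False
    using assms by simp
qed

lemma continuous_on_Moebius_function:
  assumes "cmod w < 1"
  shows "continuous_on (cball 0 1) (Moebius_function t w)"
  unfolding Moebius_function_def
  by (intro continuous_intros) (use assms one_minus_cnj_mult_nonzero in auto)

text \<open>The maximum modulus principle gives the upper bound. The difference extends continuously
  to the closed disc, so the supremum over the open disc also dominates the value at the boundary
  point \<open>z0\<close>.\<close>

lemma dist_Hinf_eq_circle_max:
  assumes u: "cmod u < 1" and v: "cmod v < 1"
    and le: "\<And>z. cmod z = 1 \<Longrightarrow> cmod (Moebius_function \<xi> u z - Moebius_function \<eta> v z) \<le> M"
    and z0: "cmod z0 = 1" and eq: "cmod (Moebius_function \<xi> u z0 - Moebius_function \<eta> v z0) = M"
  shows "dist_Hinf (disc_aut \<xi> u) (disc_aut \<eta> v) = M"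
proof -
  let ?g = "\<lambda>z. Moebius_function \<xi> u z - Moebius_function \<eta> v z"
  have cont: "continuous_on (cball 0 1) ?g"
    by (intro continuous_intros continuous_on_Moebius_function u v)
  have bound: "cmod (?g z) \<le> M" if "z \<in> unit_disc" for z
  proof (rule maximum_modulus_frontier [where S = unit_disc and f = ?g])
    show "?g holomorphic_on interior unit_disc"
      using u v by (auto intro!: holomorphic_intros Moebius_function_holomorphic)
    show "continuous_on (closure unit_disc) ?g"
      using cont by simp
  qed (use le that in auto)
  have dist: "dist_Hinf (disc_aut \<xi> u) (disc_aut \<eta> v) = (SUP z\<in>unit_disc. cmod (?g z))"
    unfolding dist_Hinf_def by (intro SUP_cong) (auto simp: disc_aut_def)
  have "(SUP z\<in>unit_disc. cmod (?g z)) \<le> M"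
    by (rule cSUP_least) (use bound in auto)
  moreover have "M \<le> (SUP z\<in>unit_disc. cmod (?g z))"
  proof -
    \<comment> \<open>This set is closed and contains the disc, hence also
      \<open>z0\<close>.\<close>
    have "closure unit_disc \<subseteq> {z \<in> cball 0 1. cmod (?g z) \<le> (SUP z\<in>unit_disc. cmod (?g z))}"
    proof (rule closure_minimal)
      have "bdd_above ((\<lambda>z. cmod (?g z)) ` unit_disc)"
        using bound by (auto intro!: bdd_aboveI2)
      then show "unit_disc \<subseteq> {z \<in> cball 0 1. cmod (?g z) \<le> (SUP z\<in>unit_disc. cmod (?g z))}"
        by (auto intro!: cSUP_upper)
      show "closed {z \<in> cball 0 1. cmod (?g z) \<le> (SUP z\<in>unit_disc. cmod (?g z))}"
        by (rule continuous_on_closed_Collect_le) (intro continuous_intros cont closed_cball)+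
    qed
    then show ?thesis
      using z0 eq by (auto simp: subset_iff)
  qed
  ultimately show ?thesis
    using dist by simp
qed

section \<open>The difference on the unit circle in terms of a point \<open>b\<close> with |b - 1| =
  \<rho>(u, v)\<close>

abbreviation aut_angle :: "real \<Rightarrow> real \<Rightarrow> complex \<Rightarrow> complex \<Rightarrow> complex" where
  "aut_angle \<xi> \<eta> u v \<equiv> exp (\<i> * of_real (\<eta> - \<xi>)) * ((1 - cnj u * v) / (1 - u * cnj v))"

lemma pseudo_dist_eq: "pseudo_dist u v = cmod (u - v) / cmod (1 - cnj v * u)"
proof -
  have "1 - cnj u * v = cnj (1 - cnj v * u)"
    by simp
  then show ?thesis
    unfolding pseudo_dist_def norm_divide by (simp only: complex_mod_cnj)
qed

text \<open>The ratio of \<open>1 - cnj v * z\<close> and \<open>1 - cnj u * z\<close> is a Moebius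
  transformation in \<open>z\<close>, so it maps the unit circle to a circle. The remaining constant
  factor of \<open>b\<close> moves the centre to 1, and its argument accounts for the passage from
  exp(i(\<eta> - \<xi>)) to \<lambda> = \<mu>^2.\<close>

lemma Moebius_function_diff_circle:
  fixes u v z \<mu> :: complex
  defines "b \<equiv> (1 - cnj v * z) * (1 - cnj u * u) / ((1 - cnj u * z) * (1 - cnj v * u))"
  assumes u: "cmod u < 1" and v: "cmod v < 1" and z: "cmod z = 1"
    and \<mu>: "cmod \<mu> = 1" "\<mu>\<^sup>2 = aut_angle \<xi> \<eta> u v"
  shows "cmod (Moebius_function \<xi> u z - Moebius_function \<eta> v z) = 2 * \<bar>Im (cnj \<mu> * b)\<bar> / cmod b"
    and "cmod (b - 1) = pseudo_dist u v" and "b \<noteq> 0"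
proof -
  define A where "A = 1 - cnj u * z"
  define B where "B = 1 - cnj v * z"
  define C where "C = 1 - cnj v * u"
  define K where "K = 1 - cnj u * u"
  define E where "E = exp (\<i> * of_real (\<eta> - \<xi>))"
  have nz: "A \<noteq> 0" "B \<noteq> 0" "C \<noteq> 0" "K \<noteq> 0"
    using u v z one_minus_cnj_mult_nonzero unfolding A_def B_def C_def K_def by force+
  have b: "b = B * K / (A * C)"
    unfolding b_def A_def B_def C_def K_def ..
  show "b \<noteq> 0"
    using nz by (simp add: b)
  have zz: "z * cnj z = 1" and \<mu>\<mu>: "\<mu> * cnj \<mu> = 1"
    using z \<mu> by (simp_all flip: complex_norm_square)
  \<comment> \<open>Since \<open>cnj z\<close> is the inverse of \<open>z\<close>, each numerator is
    \<open>z\<close> times the conjugate of its denominator.\<close>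
  have zA: "z - w = z * cnj (1 - cnj w * z)" for w
    using zz by (simp add: algebra_simps)
  have K: "cnj K = K"
    by (simp add: K_def mult.commute)
  have E: "exp (\<i> * of_real \<eta>) = exp (\<i> * of_real \<xi>) * E"
    by (simp add: E_def flip: exp_add) (simp add: algebra_simps)
  have \<lambda>: "\<mu>\<^sup>2 = E * (cnj C / C)"
    using \<mu> by (simp add: E_def C_def mult.commute)
  have "Moebius_function \<xi> u z - Moebius_function \<eta> v z =
      exp (\<i> * of_real \<xi>) * z * (cnj A / A) * (1 - E * (cnj B * A) / (B * cnj A))"
    unfolding Moebius_function_def zA[of u] zA[of v] E A_def[symmetric] B_def[symmetric]
    using nz by (simp add: field_simps)
  also have "E * (cnj B * A) / (B * cnj A) = \<mu>\<^sup>2 * (cnj b / b)"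
    unfolding \<lambda> b using nz K by (simp add: field_simps)
  \<comment> \<open>Pulling out \<mu> and using \<open>\<mu> * cnj \<mu> = 1\<close> leaves a number
    minus its own conjugate, which is purely imaginary.\<close>
  also have "1 - \<mu>\<^sup>2 * (cnj b / b) = \<mu> * (cnj \<mu> * b - cnj (cnj \<mu> * b)) / b"
    using \<open>b \<noteq> 0\<close> \<mu>\<mu> by (simp add: field_simps power2_eq_square)
  also have "cnj \<mu> * b - cnj (cnj \<mu> * b) = 2 * \<i> * of_real (Im (cnj \<mu> * b))"
    by (simp add: complex_eq_iff)
  also have "cmod (exp (\<i> * of_real \<xi>) * z * (cnj A / A) * (\<mu> * (2 * \<i> * of_real t) / b)) =
      2 * \<bar>t\<bar> / cmod b" for t
    using z \<mu> nz by (simp add: norm_mult norm_divide)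
  finally show "cmod (Moebius_function \<xi> u z - Moebius_function \<eta> v z) = 2 * \<bar>Im (cnj \<mu> * b)\<bar> / cmod b" .
  have "b - 1 = (cnj u - cnj v) * (z - u) / (A * C)"
    using nz unfolding b by (simp add: field_simps) (simp add: A_def B_def C_def K_def algebra_simps)
  also have "z - u = z * cnj A"
    unfolding A_def by (rule zA)
  also have "cmod ((cnj u - cnj v) * (z * cnj A) / (A * C)) = cmod (cnj (u - v)) / cmod (cnj C)"
    using nz z by (simp add: norm_mult norm_divide)
  also have "\<dots> = pseudo_dist u v"
    unfolding complex_mod_cnj by (simp add: C_def pseudo_dist_eq)
  finally show "cmod (b - 1) = pseudo_dist u v" .
qed

lemma pseudo_dist_lt_1:
  assumes "cmod u < 1" "cmod v < 1"
  shows "pseudo_dist u v < 1"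
  using Moebius_function_norm_lt_1[OF assms, of 0]
  by (simp add: Moebius_function_simple pseudo_dist_def norm_minus_commute norm_divide)

text \<open>For u = v the circle is the single point 1. Otherwise \<open>b - 1\<close> is a constant
  multiple of (z - u) / (1 - cnj u z), a Moebius map that preserves the unit circle and can be
  inverted.\<close>

lemma circle_quotient_surj:
  assumes u: "cmod u < 1" and v: "cmod v < 1" and b: "cmod (b - 1) = pseudo_dist u v"
  obtains z where "cmod z = 1"
    "b = (1 - cnj v * z) * (1 - cnj u * u) / ((1 - cnj u * z) * (1 - cnj v * u))"
proof (cases "u = v")
  case True
  then have "b = 1"
    using b by (simp add: pseudo_dist_def)
  moreover have "(1 - cnj u * 1) * (1 - cnj u * u) \<noteq> 0"
    using one_minus_cnj_mult_nonzero[OF u, of 1] one_minus_cnj_mult_nonzero[OF u, of u] u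
    unfolding mult_eq_0_iff by simp
  ultimately show ?thesis
    using True that[of 1] by simp
next
  case False
  define C where "C = 1 - cnj v * u"
  define K where "K = 1 - cnj u * u"
  \<comment> \<open>The value that (z - u) / (1 - cnj u z) must take; \<open>z\<close> is then
    recovered by the inverse Moebius map.\<close>
  define w where "w = (b - 1) * C / (cnj u - cnj v)"
  have nz: "C \<noteq> 0" "K \<noteq> 0" "cnj u - cnj v \<noteq> 0"
    using u v one_minus_cnj_mult_nonzero False unfolding C_def K_def by force+
  have "pseudo_dist u v = cmod (cnj (u - v)) / cmod (cnj C)"
    unfolding complex_mod_cnj by (simp add: C_def pseudo_dist_eq)
  then have w1: "cmod w = 1"
    using b nz False by (simp add: w_def norm_mult norm_divide flip: complex_cnj_diff)
  then have ww: "w * cnj w = 1"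
    by (simp flip: complex_norm_square)
  have D: "1 + cnj u * w \<noteq> 0"
    using one_minus_cnj_mult_nonzero[of "-u" w] u w1 by simp
  define z where "z = (w + u) / (1 + cnj u * w)"
  have "w + u = w * cnj (1 + cnj u * w)"
    using ww by (simp add: algebra_simps)
  then have "cmod z = cmod w * cmod (1 + cnj u * w) / cmod (1 + cnj u * w)"
    unfolding z_def norm_divide by (simp only: norm_mult complex_mod_cnj)
  then have "cmod z = 1"
    using D w1 by simp
  have A: "1 - cnj u * z = K / (1 + cnj u * w)"
    using D by (simp add: z_def K_def field_simps)
  have B: "1 - cnj v * z = (C + (cnj u - cnj v) * w) / (1 + cnj u * w)"
    using D by (simp add: z_def C_def field_simps)
  have "(cnj u - cnj v) * w = (b - 1) * C"
    using nz by (simp add: w_def)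
  then have "C + (cnj u - cnj v) * w = b * C"
    by (simp add: algebra_simps)
  then have "b = (1 - cnj v * z) * K / ((1 - cnj u * z) * C)"
    unfolding A B using nz D by simp
  then show ?thesis
    using \<open>cmod z = 1\<close> that by (simp add: C_def K_def)
qed

text \<open>As \<open>z\<close> runs through the unit circle, \<open>b\<close> runs through the
  whole circle of radius \<rho>(u, v) about 1, so only a maximum over that circle is left to
  compute.\<close>

lemma dist_Hinf_eq_max:
  assumes u: "cmod u < 1" and v: "cmod v < 1"
    and \<mu>: "cmod \<mu> = 1" "\<mu>\<^sup>2 = aut_angle \<xi> \<eta> u v"
    and le: "\<And>b. cmod (b - 1) = pseudo_dist u v \<Longrightarrow> 2 * \<bar>Im (cnj \<mu> * b)\<bar> \<le> M * cmod b"
    and b: "cmod (b - 1) = pseudo_dist u v" "2 * \<bar>Im (cnj \<mu> * b)\<bar> = M * cmod b"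
  shows "dist_Hinf (disc_aut \<xi> u) (disc_aut \<eta> v) = M"
proof -
  obtain z where z: "cmod z = 1"
    "b = (1 - cnj v * z) * (1 - cnj u * u) / ((1 - cnj u * z) * (1 - cnj v * u))"
    using circle_quotient_surj[OF u v b(1)] .
  note circ = Moebius_function_diff_circle[OF u v _ \<mu>]
  show ?thesis
  proof (rule dist_Hinf_eq_circle_max[OF u v _ z(1)])
    show "cmod (Moebius_function \<xi> u z - Moebius_function \<eta> v z) = M"
      using circ[OF z(1)] b by (simp flip: z(2))
    show "cmod (Moebius_function \<xi> u z - Moebius_function \<eta> v z) \<le> M" if "cmod z = 1" for z
      unfolding circ(1)[OF that] using circ(3)[OF that] le[OF circ(2)[OF that]] by (simp add: field_simps)
  qed
qed

section \<open>The maximum over the circle |b - 1| = \<rho>(u, v)\<close>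

lemma norm_aut_angle:
  assumes "cmod u < 1" "cmod v < 1"
  shows "cmod (aut_angle \<xi> \<eta> u v) = 1"
proof -
  have "1 - u * cnj v = cnj (1 - cnj u * v)"
    by simp
  then have "cmod (1 - u * cnj v) = cmod (1 - cnj u * v)"
    by (simp only: complex_mod_cnj)
  then show ?thesis
    using one_minus_cnj_mult_nonzero[of u v] assms by (simp add: norm_mult norm_divide)
qed

text \<open>The bound |Im(cnj \<mu> b)| \<le> |b| is an equality on the real line spanned by i\<mu>.
  This line has distance Re \<mu> from 1, so for Re \<mu> \<le> \<rho> it meets the circle.\<close>

lemma dist_Hinf_eq_2:
  assumes u: "cmod u < 1" and v: "cmod v < 1"
    and \<mu>: "cmod \<mu> = 1" "\<mu>\<^sup>2 = aut_angle \<xi> \<eta> u v" and x: "0 \<le> Re \<mu>" "Re \<mu> \<le> pseudo_dist u v"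
  shows "dist_Hinf (disc_aut \<xi> u) (disc_aut \<eta> v) = 2"
proof -
  let ?r = "pseudo_dist u v"
  \<comment> \<open>A root of (s + Im \<mu>)^2 + (Re \<mu>)^2 = \<rho>^2, which says that
    \<open>\<i> * \<mu> * of_real s\<close> lies on the circle.\<close>
  define s where "s = - Im \<mu> + sqrt (?r\<^sup>2 - (Re \<mu>)\<^sup>2)"
  have xy: "(Re \<mu>)\<^sup>2 + (Im \<mu>)\<^sup>2 = 1"
    using \<mu>(1) by (simp flip: cmod_power2)
  have r: "0 \<le> ?r"
    by (simp add: pseudo_dist_def)
  have "(Re \<mu>)\<^sup>2 \<le> ?r\<^sup>2"
    using x by (intro power_mono)
  then have s: "(s + Im \<mu>)\<^sup>2 = ?r\<^sup>2 - (Re \<mu>)\<^sup>2"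
    by (simp add: s_def)
  show ?thesis
  proof (rule dist_Hinf_eq_max[OF u v \<mu>])
    show "2 * \<bar>Im (cnj \<mu> * b)\<bar> \<le> 2 * cmod b" for b
      using abs_Im_le_cmod[of "cnj \<mu> * b"] \<mu>(1) by (simp only: norm_mult complex_mod_cnj)
    have "(cmod (\<i> * \<mu> * of_real s - 1))\<^sup>2 = (Im \<mu> * s + 1)\<^sup>2 + (Re \<mu> * s)\<^sup>2"
      unfolding cmod_power2 by (simp add: power2_eq_square algebra_simps)
    also have "\<dots> = s\<^sup>2 * ((Re \<mu>)\<^sup>2 + (Im \<mu>)\<^sup>2) + 2 * s * Im \<mu> + 1"
      by (simp add: power2_eq_square algebra_simps)
    also have "\<dots> = (s + Im \<mu>)\<^sup>2 + (Re \<mu>)\<^sup>2"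
      unfolding xy using xy by (simp add: power2_eq_square algebra_simps)
    finally show "cmod (\<i> * \<mu> * of_real s - 1) = ?r"
      using s r by simp
    have "cnj \<mu> * (\<i> * \<mu> * of_real s) = \<i> * of_real s * (\<mu> * cnj \<mu>)"
      by (simp add: algebra_simps)
    also have "\<mu> * cnj \<mu> = 1"
      using \<mu>(1) by (simp flip: complex_norm_square)
    finally have im: "cnj \<mu> * (\<i> * \<mu> * of_real s) = \<i> * of_real s * 1" .
    show "2 * \<bar>Im (cnj \<mu> * (\<i> * \<mu> * of_real s))\<bar> = 2 * cmod (\<i> * \<mu> * of_real s)"
      unfolding im using \<mu>(1) by (simp add: norm_mult)
  qed
qed

text \<open>Seen from 0, the circle lies between its two tangents, whose angle with the real axis
  has sine \<open>r\<close> and cosine \<open>sqrt (1 - r\<^sup>2)\<close>. Because r < Re \<mu>,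
  the angle of \<mu> plus that of a tangent stays below a right angle, where the sine increases. The
  argument is carried out algebraically with cosines \<open>p\<close>, \<open>x\<close> and absolute
  sines \<open>q\<close>, \<open>y\<close>.\<close>

lemma abs_Im_rotated_circle_le:
  assumes xy: "(Re \<mu>)\<^sup>2 + (Im \<mu>)\<^sup>2 = 1" and r: "0 \<le> r" "r < 1" "r < Re \<mu>" and b: "cmod (b - 1) = r"
  shows "\<bar>Im (cnj \<mu> * b)\<bar> \<le> (r * Re \<mu> + sqrt (1 - r\<^sup>2) * \<bar>Im \<mu>\<bar>) * cmod b"
proof -
  define c where "c = sqrt (1 - r\<^sup>2)"
  define m where "m = cmod b"
  define p where "p = Re b / m"
  define q where "q = \<bar>Im b\<bar> / m"
  define x where "x = Re \<mu>"
  define y where "y = \<bar>Im \<mu>\<bar>"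
  have xy: "x\<^sup>2 + y\<^sup>2 = 1" and y: "0 \<le> y" and x: "r < x"
    using assms by (auto simp: x_def y_def)
  have "r\<^sup>2 < 1"
    using r by (simp add: power_less_one_iff abs_square_less_1)
  then have c: "0 < c" "c\<^sup>2 = 1 - r\<^sup>2"
    by (auto simp: c_def)
  have "b \<noteq> 0"
    using b r by auto
  then have m: "0 < m"
    by (simp add: m_def)
  have m2: "m\<^sup>2 = (Re b)\<^sup>2 + (Im b)\<^sup>2"
    by (simp add: m_def cmod_power2)
  have "r\<^sup>2 = (Re b - 1)\<^sup>2 + (Im b)\<^sup>2"
    by (simp flip: b add: cmod_power2)
  \<comment> \<open>Together with the inequality of arithmetic and geometric means this bounds the
    cosine \<open>p\<close> of the angle of \<open>b\<close> below by \<open>c\<close>.\<close>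
  then have "2 * Re b = m\<^sup>2 + c\<^sup>2"
    unfolding m2 c by (simp add: power2_eq_square algebra_simps)
  also have "\<dots> \<ge> 2 * c * m"
    using sum_squares_bound[of c m] by simp
  finally have p: "c \<le> p"
    using m by (simp add: p_def field_simps)
  have "p\<^sup>2 + q\<^sup>2 = m\<^sup>2 / m\<^sup>2"
    by (simp add: p_def q_def power_divide m2 flip: add_divide_distrib)
  then have pq: "p\<^sup>2 + q\<^sup>2 = 1"
    using m by simp
  have "c\<^sup>2 \<le> p\<^sup>2"
    using p c by (intro power_mono) auto
  then have "q\<^sup>2 \<le> r\<^sup>2"
    using pq c by linarith
  then have q: "0 \<le> q" "q \<le> r"
    using r m by (auto simp: q_def power2_le_iff_abs_le)
  have "r\<^sup>2 \<le> x\<^sup>2"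
    using r x by (intro power_mono) auto
  then have "y\<^sup>2 \<le> c\<^sup>2"
    using xy c by linarith
  then have "y \<le> c"
    using c by (simp only: power2_le_imp_le order.strict_implies_order)
  have "y * r \<le> c * x" "y * q \<le> p * x"
    using \<open>y \<le> c\<close> x y q p c r by (intro mult_mono; simp)+
  then have "(r - q) * (y * (r + q)) \<le> (r - q) * (x * (p + c))"
    using q by (intro mult_left_mono) (simp_all add: algebra_simps)
  \<comment> \<open>Both pairs (p, q) and (c, r) lie on the unit circle. This identity trades
    \<open>r - q\<close> for \<open>p - c\<close>, after which the positive factor
    \<open>p + c\<close> cancels.\<close>
  moreover have "(r - q) * (r + q) = (p - c) * (p + c)"
    using pq c by (simp add: power2_eq_square algebra_simps)
  ultimately have "(y * (p - c)) * (p + c) \<le> (x * (r - q)) * (p + c)"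
    by (simp add: mult_ac)
  then have "y * (p - c) \<le> x * (r - q)"
    using p c by (simp add: mult_le_cancel_right)
  then have "x * q + y * p \<le> r * x + c * y"
    by (simp add: algebra_simps)
  then have "(x * q + y * p) * m \<le> (r * x + c * y) * m"
    using m by (intro mult_right_mono) auto
  moreover have "\<bar>Im (cnj \<mu> * b)\<bar> \<le> x * \<bar>Im b\<bar> + y * Re b"
  proof -
    have "0 < Re b / m"
      using p c by (simp add: p_def)
    then have "0 \<le> x" "0 \<le> Re b"
      using x r m by (auto simp: zero_less_divide_iff)
    then have "x * \<bar>Im b\<bar> + y * Re b = \<bar>Re \<mu> * Im b\<bar> + \<bar>Im \<mu> * Re b\<bar>"
      by (simp add: x_def y_def abs_mult)
    then show ?thesis
      by simp
  qed
  moreover have "(x * q + y * p) * m = x * \<bar>Im b\<bar> + y * Re b"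
    using m by (simp add: p_def q_def field_simps)
  ultimately show ?thesis
    by (simp add: x_def y_def c_def m_def)
qed

lemma dist_Hinf_lt_2_eq:
  assumes u: "cmod u < 1" and v: "cmod v < 1"
    and \<mu>: "cmod \<mu> = 1" "\<mu>\<^sup>2 = aut_angle \<xi> \<eta> u v" and x: "pseudo_dist u v < Re \<mu>"
  shows "dist_Hinf (disc_aut \<xi> u) (disc_aut \<eta> v) =
     2 * (pseudo_dist u v * Re \<mu> + sqrt (1 - (pseudo_dist u v)\<^sup>2) * \<bar>Im \<mu>\<bar>)"
proof -
  define r where "r = pseudo_dist u v"
  define c where "c = sqrt (1 - r\<^sup>2)"
  have r: "0 \<le> r" "r < 1"
    using pseudo_dist_lt_1[OF u v] by (simp_all add: r_def pseudo_dist_def)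
  then have "r\<^sup>2 < 1"
    by (simp add: power_less_one_iff abs_square_less_1)
  then have c: "0 < c" "c\<^sup>2 = 1 - r\<^sup>2"
    by (auto simp: c_def)
  have xy: "(Re \<mu>)\<^sup>2 + (Im \<mu>)\<^sup>2 = 1"
    using \<mu>(1) by (simp flip: cmod_power2)
  \<comment> \<open>The sign places the point of tangency on the side of the real axis away from
    \<mu>, so that the two angles add up.\<close>
  define \<sigma> :: real where "\<sigma> = (if 0 \<le> Im \<mu> then -1 else 1)"
  have \<sigma>: "\<sigma>\<^sup>2 = 1"
    by (simp add: \<sigma>_def)
  \<comment> \<open>The tangent from 0 has length \<open>c\<close> and direction c +
    i\<sigma>r.\<close>
  define b where "b = c * Complex c (\<sigma> * r)"
  show ?thesis
    unfolding r_def[symmetric] c_def[symmetric]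
  proof (rule dist_Hinf_eq_max[OF u v \<mu>, folded r_def])
    have "r < Re \<mu>"
      using x by (simp add: r_def)
    then show "2 * \<bar>Im (cnj \<mu> * b)\<bar> \<le> 2 * (r * Re \<mu> + c * \<bar>Im \<mu>\<bar>) * cmod b" if "cmod (b - 1) = r" for b
      using abs_Im_rotated_circle_le[OF xy r _ that]
      unfolding c_def mult.assoc by (intro mult_left_mono) auto
    have "(cmod (b - 1))\<^sup>2 = (c\<^sup>2 - 1)\<^sup>2 + c\<^sup>2 * (\<sigma>\<^sup>2 * r\<^sup>2)"
      unfolding cmod_power2 by (simp add: b_def power2_eq_square)
    also have "\<dots> = r\<^sup>2"
      unfolding \<sigma> c by (simp add: power2_eq_square algebra_simps)
    finally show "cmod (b - 1) = r"
      using r by simp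
    have "(cmod b)\<^sup>2 = c\<^sup>2 * (c\<^sup>2 + \<sigma>\<^sup>2 * r\<^sup>2)"
      unfolding cmod_power2 by (simp add: b_def power2_eq_square algebra_simps)
    then have "(cmod b)\<^sup>2 = c\<^sup>2"
      using \<sigma> c by simp
    then have "cmod b = c"
      using c(1) by (simp only: power2_eq_iff_nonneg norm_ge_zero order.strict_implies_order)
    moreover have "Im (cnj \<mu> * b) = (\<sigma> * r * Re \<mu> - Im \<mu> * c) * c"
      by (simp add: b_def algebra_simps)
    then have "\<bar>Im (cnj \<mu> * b)\<bar> = \<bar>\<sigma> * r * Re \<mu> - Im \<mu> * c\<bar> * c"
      using c(1) by (simp only: abs_mult abs_of_pos)
    moreover have "\<bar>\<sigma> * r * Re \<mu> - Im \<mu> * c\<bar> = r * Re \<mu> + c * \<bar>Im \<mu>\<bar>"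
    proof -
      have "0 \<le> r * Re \<mu>" "0 \<le> c * \<bar>Im \<mu>\<bar>"
        using r c x by (auto simp: r_def)
      then show ?thesis
        by (auto simp: \<sigma>_def mult.commute abs_if)
    qed
    ultimately show "2 * \<bar>Im (cnj \<mu> * b)\<bar> = 2 * (r * Re \<mu> + c * \<bar>Im \<mu>\<bar>) * cmod b"
      by simp
  qed
qed

text \<open>The two numbers are the squares of c - ir and x + i|y|, both of modulus 1. The
  difference of the squares of two unit numbers \<alpha>, \<beta> has modulus 2 |Im(cnj \<alpha>
  \<beta>)|.\<close>

lemma cmod_unit_square_diff:
  assumes xy: "x\<^sup>2 + y\<^sup>2 = 1" and r: "r\<^sup>2 + c\<^sup>2 = (1::real)" and "0 \<le> r" "0 \<le> c" "0 \<le> x"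
  shows "cmod (Complex (1 - 2 * r\<^sup>2) (- (2 * r * c)) - Complex (x\<^sup>2 - y\<^sup>2) \<bar>2 * x * y\<bar>) =
    2 * (r * x + c * \<bar>y\<bar>)"
proof -
  define Y where "Y = \<bar>y\<bar>"
  have Y: "0 \<le> Y" "y\<^sup>2 = Y\<^sup>2" "\<bar>2 * x * y\<bar> = 2 * x * Y"
    using assms by (auto simp: Y_def abs_mult)
  have c2: "c * c = 1 - r * r" and Y2: "Y * Y = 1 - x * x"
    using assms Y by (simp_all add: power2_eq_square)
  have "(cmod (Complex (1 - 2 * r\<^sup>2) (- (2 * r * c)) - Complex (x\<^sup>2 - y\<^sup>2) \<bar>2 * x * y\<bar>))\<^sup>2
     = (1 - 2 * r\<^sup>2 - (x\<^sup>2 - Y\<^sup>2))\<^sup>2 + (2 * r * c + 2 * x * Y)\<^sup>2"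
    unfolding Y cmod_power2 by (simp add: power2_eq_square algebra_simps)
  also have "\<dots> = (2 * (r * x + c * Y))\<^sup>2"
    using c2 Y2 by algebra
  finally show ?thesis
    unfolding Y_def[symmetric]
    by (rule power2_eq_imp_eq) (use assms Y in auto)
qed

text \<open>For the principal root, \<omega> + 1 = \<mu>(\<mu> + cnj \<mu>) = 2 \<mu> Re \<mu>. This
  turns the comparison of |\<lambda> + 1| with 2\<rho> into that of Re \<mu> with \<rho>.\<close>

lemma unit_sqrt:
  assumes "cmod \<omega> = 1"
  obtains \<mu> where "cmod \<mu> = 1" "\<mu>\<^sup>2 = \<omega>" "0 \<le> Re \<mu>" "cmod (\<omega> + 1) = 2 * Re \<mu>"
proof -
  define \<mu> where "\<mu> = csqrt \<omega>"
  have \<mu>: "cmod \<mu> = 1" "\<mu>\<^sup>2 = \<omega>" "0 \<le> Re \<mu>"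
    using assms csqrt_principal[of \<omega>] by (auto simp: \<mu>_def simp del: csqrt.simps)
  then have "\<mu> * cnj \<mu> = 1"
    by (simp flip: complex_norm_square)
  then have "\<omega> + 1 = \<mu> * (\<mu> + cnj \<mu>)"
    by (simp add: \<mu>(2)[symmetric] power2_eq_square algebra_simps)
  then have "cmod (\<omega> + 1) = 2 * Re \<mu>"
    using \<mu> by (simp add: norm_mult complex_add_cnj del: of_real_mult)
  with \<mu> show ?thesis
    using that by blast
qed

lemma dist_Hinf_formula:
  fixes \<xi> \<eta> :: real and u v :: complex
  assumes u: "cmod u < 1" and v: "cmod v < 1"
  defines "l \<equiv> aut_angle \<xi> \<eta> u v" and "r \<equiv> pseudo_dist u v"
  shows "cmod (l + 1) \<le> 2 * r \<Longrightarrow> dist_Hinf (disc_aut \<xi> u) (disc_aut \<eta> v) = 2"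
    and "cmod (l + 1) > 2 * r \<Longrightarrow> dist_Hinf (disc_aut \<xi> u) (disc_aut \<eta> v) =
       cmod ((1 - 2 * of_real (r\<^sup>2) - 2 * \<i> * of_real r * of_real (sqrt (1 - r\<^sup>2)))
             - (of_real (Re l) + \<i> * of_real \<bar>Im l\<bar>))" (is "_ \<Longrightarrow> _ = cmod (?a - ?b)")
proof -
  have "cmod l = 1"
    unfolding l_def by (rule norm_aut_angle[OF u v])
  then obtain \<mu> where \<mu>: "cmod \<mu> = 1" "\<mu>\<^sup>2 = l" "0 \<le> Re \<mu>" "cmod (l + 1) = 2 * Re \<mu>"
    by (rule unit_sqrt)
  show "dist_Hinf (disc_aut \<xi> u) (disc_aut \<eta> v) = 2" if "cmod (l + 1) \<le> 2 * r"
    using dist_Hinf_eq_2[OF u v \<mu>(1) \<mu>(2)[unfolded l_def] \<mu>(3)] that \<mu>(4) by (simp add: r_def)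
  assume "cmod (l + 1) > 2 * r"
  then have less: "r < Re \<mu>"
    using \<mu>(4) by simp
  have r: "0 \<le> r" "r < 1"
    using pseudo_dist_lt_1[OF u v] by (simp_all add: r_def pseudo_dist_def)
  then have "r\<^sup>2 \<le> 1"
    by (simp add: power_le_one)
  have "?a = Complex (1 - 2 * r\<^sup>2) (- (2 * r * sqrt (1 - r\<^sup>2)))"
    by (simp add: complex_eq_iff power2_eq_square)
  moreover have "?b = Complex ((Re \<mu>)\<^sup>2 - (Im \<mu>)\<^sup>2) \<bar>2 * Re \<mu> * Im \<mu>\<bar>"
    by (simp add: complex_eq_iff flip: \<mu>(2)) (simp add: power2_eq_square algebra_simps)
  ultimately have "cmod (?a - ?b) = 2 * (r * Re \<mu> + sqrt (1 - r\<^sup>2) * \<bar>Im \<mu>\<bar>)"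
    using cmod_unit_square_diff[of "Re \<mu>" "Im \<mu>" r "sqrt (1 - r\<^sup>2)"] \<mu> r \<open>r\<^sup>2 \<le> 1\<close>
    by (simp flip: cmod_power2)
  then show "dist_Hinf (disc_aut \<xi> u) (disc_aut \<eta> v) = cmod (?a - ?b)"
    using dist_Hinf_lt_2_eq[OF u v \<mu>(1) \<mu>(2)[unfolded l_def]] less by (simp add: r_def)
qed

section \<open>The automorphism group\<close>

lemma Moebius_function_rotate: "Moebius_function \<xi> u z = exp (\<i> * of_real \<xi>) * Moebius_function 0 u z"
  by (simp add: Moebius_function_def)

lemma disc_aut_in_Aut_disc:
  assumes u: "cmod u < 1"
  shows "disc_aut \<xi> u \<in> Aut_disc"
proof -
  let ?f = "disc_aut \<xi> u"
  \<comment> \<open>The explicit inverse: undo the rotation, then apply the Moebius function with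
    parameter -u.\<close>
  let ?g = "\<lambda>z. Moebius_function 0 (- u) (exp (- (\<i> * of_real \<xi>)) * z)"
  have f: "?f z = Moebius_function \<xi> u z" if "z \<in> unit_disc" for z
    using that by (simp add: disc_aut_def)
  have g_in: "?g z \<in> unit_disc" if "z \<in> unit_disc" for z
    using that u by (simp add: Moebius_function_norm_lt_1 norm_mult)
  have f_in: "?f z \<in> unit_disc" if "z \<in> unit_disc" for z
    using that u by (simp add: f Moebius_function_norm_lt_1)
  have gf: "?g (?f z) = z" if "z \<in> unit_disc" for z
  proof -
    have "exp (- (\<i> * of_real \<xi>)) * ?f z = Moebius_function 0 u z"
      using that by (simp add: f Moebius_function_rotate[of \<xi>] exp_minus)
    then show ?thesis
      using that u by (simp add: Moebius_function_compose)
  qed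
  have fg: "?f (?g z) = z" if "z \<in> unit_disc" for z
    using that u g_in[OF that]
    by (simp add: f Moebius_function_rotate[of \<xi>] Moebius_function_compose norm_mult norm_inverse exp_minus)
  have bij: "bij_betw ?f unit_disc unit_disc"
    using f_in g_in gf fg by (intro bij_betw_byWitness[where f' = ?g]) auto
  have "?g holomorphic_on unit_disc"
    by (rule holomorphic_on_compose[unfolded o_def, where g = "Moebius_function 0 (- u)"])
      (use u in \<open>auto intro!: holomorphic_intros
        holomorphic_on_subset[OF Moebius_function_holomorphic] simp: norm_mult\<close>)
  moreover have "inv_into unit_disc ?f z = ?g z" if "z \<in> unit_disc" for z
    using that bij fg g_in by (metis bij_betw_def inv_into_f_eq)
  ultimately have "inv_into unit_disc ?f holomorphic_on unit_disc"
    using holomorphic_transform by metis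
  moreover have "?f holomorphic_on unit_disc"
    using holomorphic_transform[OF Moebius_function_holomorphic[OF u]] f by metis
  ultimately show ?thesis
    using bij by (auto simp: Aut_disc_def disc_aut_def)
qed

text \<open>Let u be the zero of \<phi>. Composing \<phi> with the Moebius function that sends 0 to
  u gives an automorphism fixing 0, which the Schwarz lemma identifies as a rotation.\<close>

lemma Aut_disc_cases:
  assumes "\<phi> \<in> Aut_disc"
  obtains \<xi> u where "cmod u < 1" "\<phi> = disc_aut \<xi> u"
proof -
  define \<psi> where "\<psi> = inv_into unit_disc \<phi>"
  have ext: "\<phi> \<in> extensional unit_disc" and hol: "\<phi> holomorphic_on unit_disc" "\<psi> holomorphic_on unit_disc"
    and bij: "bij_betw \<phi> unit_disc unit_disc"
    using assms by (auto simp: Aut_disc_def \<psi>_def)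
  have bij': "bij_betw \<psi> unit_disc unit_disc"
    unfolding \<psi>_def by (rule bij_betw_inv_into[OF bij])
  have \<phi>: "\<phi> z \<in> unit_disc" "\<psi> (\<phi> z) = z" and \<psi>: "\<psi> z \<in> unit_disc" "\<phi> (\<psi> z) = z"
    if "z \<in> unit_disc" for z
    using bij_betw_apply[OF bij that] bij_betw_apply[OF bij' that]
      bij_betw_inv_into_left[OF bij that, folded \<psi>_def] bij_betw_inv_into_right[OF bij that, folded \<psi>_def]
    by simp_all
  define u where "u = \<psi> 0"
  have u: "cmod u < 1" "\<phi> u = 0"
    using \<psi>[of 0] by (auto simp: u_def)
  define F where "F = (\<lambda>z. \<phi> (Moebius_function 0 (- u) z))"
  define G where "G = (\<lambda>z. Moebius_function 0 u (\<psi> z))"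
  have F: "F holomorphic_on unit_disc" "F 0 = 0" "cmod z < 1 \<Longrightarrow> cmod (F z) < 1" for z
    unfolding F_def
    by (rule holomorphic_on_compose_gen[unfolded o_def, OF Moebius_function_holomorphic hol(1)])
      (use u \<phi>(1) Moebius_function_norm_lt_1[of "- u"] in \<open>auto simp: Moebius_function_of_zero\<close>)
  have G: "G holomorphic_on unit_disc" "G 0 = 0" "cmod z < 1 \<Longrightarrow> cmod (G z) < 1" for z
    unfolding G_def
    by (rule holomorphic_on_compose_gen[unfolded o_def, OF hol(2) Moebius_function_holomorphic])
      (use u \<psi>(1) Moebius_function_norm_lt_1[of u] in \<open>auto simp: Moebius_function_eq_zero simp flip: u_def\<close>)
  have "G (F z) = z" if "cmod z < 1" for z
    using \<phi>(2)[of "Moebius_function 0 (- u) z"] that u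
    by (simp add: F_def G_def Moebius_function_norm_lt_1 Moebius_function_compose)
  \<comment> \<open>The Schwarz lemma is applied in both directions, to \<open>F\<close> at
    \<open>z\<close> and to its left inverse \<open>G\<close> at \<open>F z\<close>.\<close>
  then have "cmod (F z) = cmod z" if "cmod z < 1" for z
    using Schwarz_Lemma(1)[OF F that] Schwarz_Lemma(1)[OF G F(3)[OF that]] that by simp
  \<comment> \<open>Equality in the Schwarz lemma at one nonzero point forces a rotation; 1/2 is
    such a point.\<close>
  then have "\<exists>z. cmod z < 1 \<and> z \<noteq> 0 \<and> cmod (F z) = cmod z"
    by (intro exI[of _ "1/2"]) simp
  then obtain \<alpha> where \<alpha>: "\<And>z. cmod z < 1 \<Longrightarrow> F z = \<alpha> * z" "cmod \<alpha> = 1"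
    using Schwarz_Lemma(3)[OF F, of 0] by auto
  define \<xi> where "\<xi> = Arg \<alpha>"
  have \<xi>: "\<alpha> = exp (\<i> * of_real \<xi>)"
    unfolding \<xi>_def using complex_norm_eq_1_exp_eq[THEN iffD1, OF \<alpha>(2)] by (rule sym)
  have "\<phi> z = disc_aut \<xi> u z" for z
  proof (cases "z \<in> unit_disc")
    case True
    then have "\<phi> z = F (Moebius_function 0 u z)"
      using u by (simp add: F_def Moebius_function_compose)
    also have "\<dots> = \<alpha> * Moebius_function 0 u z"
      using True u by (simp add: \<alpha> Moebius_function_norm_lt_1)
    also have "\<dots> = Moebius_function \<xi> u z"
      unfolding \<xi> by (rule Moebius_function_rotate[symmetric])
    finally show ?thesis
      using True by (simp add: disc_aut_def)
  next
    case False
    then show ?thesis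
      using extensional_arb[OF ext False] by (simp add: disc_aut_def)
  qed
  then have "\<phi> = disc_aut \<xi> u"
    by (rule HOL.ext)
  with u(1) show ?thesis
    by (rule that)
qed

text \<open>The parameter u is the zero of the automorphism. The angle is determined only up to
  multiples of 2\<pi>.\<close>

lemma disc_aut_inj:
  assumes "cmod u < 1" "cmod v < 1" "disc_aut \<xi> u = disc_aut \<eta> v"
  shows "u = v"
proof -
  have "disc_aut \<xi> u u = disc_aut \<eta> v u"
    using assms(3) by simp
  then have "Moebius_function \<xi> u u = Moebius_function \<eta> v u"
    using assms(1) by (simp add: disc_aut_def)
  then show ?thesis
    using assms one_minus_cnj_mult_nonzero[of v u] by (auto simp: Moebius_function_def)
qed

text \<open>The choice in \<open>disc_coords\<close> may return another angle \<eta>, which is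
  harmless because the limit defining the structure does not depend on the angle.\<close>

lemma disc_coords_disc_aut:
  assumes "cmod u < 1"
  obtains \<eta> where "disc_coords (disc_aut \<xi> u) = (\<eta>, u)"
proof -
  have "\<exists>p. snd p \<in> unit_disc \<and> disc_aut \<xi> u = disc_aut (fst p) (snd p)"
    using assms by (intro exI[of _ "(\<xi>, u)"]) auto
  from someI_ex[OF this, folded disc_coords_def]
  have "u = snd (disc_coords (disc_aut \<xi> u))"
    by (intro disc_aut_inj[OF assms]) auto
  then show ?thesis
    using that by (metis prod.collapse)
qed

section \<open>The induced structure\<close>

text \<open>For small t > 0 the distance is 2 (\<rho> Re \<mu> + sqrt(1 - \<rho>^2) |Im \<mu>|).
  Dividing by t, the first term gives the rate of \<rho>, the second that of half the argument of
  \<lambda>.\<close>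

lemma dist_Hinf_quotient_tendsto:
  assumes u: "cmod u < 1"
  shows "((\<lambda>t. dist_Hinf (disc_aut \<xi> u) (disc_aut (\<xi> + s * t) (u + h * of_real t)) / t) \<longlongrightarrow>
      (2 * cmod h + \<bar>2 * Im (cnj u * h) - s * (1 - (cmod u)\<^sup>2)\<bar>) / (1 - (cmod u)\<^sup>2)) (at_right 0)"
proof -
  define K where "K = 1 - (cmod u)\<^sup>2"
  define w where "w = cnj u * h"
  define l where "l t = aut_angle \<xi> (\<xi> + s * t) u (u + h * of_real t)" for t
  define r where "r t = pseudo_dist u (u + h * of_real t)" for t
  \<comment> \<open>The real part of the principal square root of \<open>l t\<close>.\<close>
  define X where "X t = sqrt ((1 + Re (l t)) / 2)" for t
  have "(cmod u)\<^sup>2 < 1"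
    using u by (simp add: abs_square_less_1)
  then have K: "K > 0"
    by (simp add: K_def)
  have KC: "1 - cnj u * u = of_real K" "1 - u * cnj u = of_real K"
    using complex_norm_square[of u] by (simp_all add: K_def mult.commute)
  \<comment> \<open>An extension of \<open>l\<close> to complex times: \<open>w\<close> and
    \<open>cnj w\<close> are constants here, so \<Lambda> is a function of one complex variable that
    can be differentiated at 0.\<close>
  define \<Lambda> where "\<Lambda> \<tau> = exp (\<i> * of_real s * \<tau>) * ((of_real K - w * \<tau>) / (of_real K - cnj w * \<tau>))"
    for \<tau> :: complex
  have l: "l t = \<Lambda> (of_real t)" for t
    by (simp add: l_def \<Lambda>_def w_def algebra_simps flip: KC)
  have "(\<Lambda> has_field_derivative \<i> * of_real s + (cnj w - w) / of_real K) (at 0)"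
    unfolding \<Lambda>_def using K by (auto intro!: derivative_eq_intros simp: field_simps power2_eq_square)
  then have "((\<lambda>\<tau>. (\<Lambda> \<tau> - 1) / \<tau>) \<longlongrightarrow> \<i> * of_real s + (cnj w - w) / of_real K) (at 0)"
    using K by (simp add: has_field_derivative_iff) (simp add: \<Lambda>_def)
  moreover have of_real0: "filterlim complex_of_real (at 0) (at_right 0)"
    unfolding filterlim_at by (auto intro!: tendsto_eq_intros eventually_at_right_less simp: eventually_at_filter)
  ultimately have "((\<lambda>t. (l t - 1) / of_real t) \<longlongrightarrow> \<i> * of_real s + (cnj w - w) / of_real K) (at_right 0)"
    unfolding l by (rule filterlim_compose)
  then have "((\<lambda>t. Im ((l t - 1) / of_real t)) \<longlongrightarrow> Im (\<i> * of_real s + (cnj w - w) / of_real K)) (at_right 0)"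
    by (rule tendsto_Im)
  moreover have "Im (\<i> * of_real s + (cnj w - w) / of_real K) = s - 2 * Im w / K"
    by simp
  ultimately have lim_Im: "((\<lambda>t. Im (l t) / t) \<longlongrightarrow> s - 2 * Im w / K) (at_right 0)"
    by simp
  have lim_l: "(l \<longlongrightarrow> 1) (at_right 0)"
    unfolding l \<Lambda>_def using K by (auto intro!: tendsto_eq_intros)
  then have lim_X: "(X \<longlongrightarrow> 1) (at_right 0)"
    unfolding X_def by (auto intro!: tendsto_eq_intros)
  \<comment> \<open>The quotient of \<rho> by |t|, continued to t = 0, where its value is |h| / (1 -
    |u|^2).\<close>
  define q where "q t = cmod h / cmod (of_real K - w * of_real t)" for t :: real
  have r: "r t = q t * \<bar>t\<bar>" for t
  proof -
    have "1 - cnj u * (u + h * of_real t) = of_real K - w * of_real t"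
      by (simp add: w_def algebra_simps flip: KC)
    then show ?thesis
      by (simp add: r_def pseudo_dist_def q_def norm_divide norm_mult)
  qed
  have lim_q: "(q \<longlongrightarrow> cmod h / K) (at_right 0)"
    unfolding q_def using K by (auto intro!: tendsto_eq_intros)
  have lim_r: "(r \<longlongrightarrow> 0) (at_right 0)"
    unfolding r by (auto intro!: tendsto_eq_intros lim_q)
  have "((\<lambda>t. 2 * (q t * X t + sqrt (1 - (r t)\<^sup>2) * (\<bar>Im (l t) / t\<bar> / (2 * X t)))) \<longlongrightarrow>
      2 * (cmod h / K * 1 + sqrt (1 - 0\<^sup>2) * (\<bar>s - 2 * Im w / K\<bar> / (2 * 1)))) (at_right 0)"
    by (intro tendsto_intros lim_q lim_X lim_Im lim_r) simp
  also have "2 * (cmod h / K * 1 + sqrt (1 - 0\<^sup>2) * (\<bar>s - 2 * Im w / K\<bar> / (2 * 1))) =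
      (2 * cmod h + \<bar>2 * Im w - s * K\<bar>) / K"
  proof -
    have "\<bar>s - 2 * Im w / K\<bar> = \<bar>(2 * Im w - s * K) / K\<bar>"
      using K by (simp add: field_simps abs_minus_commute)
    also have "\<dots> = \<bar>2 * Im w - s * K\<bar> / K"
      using K by simp
    finally show ?thesis
      by (simp add: add_divide_distrib)
  qed
  also have "((\<lambda>t. 2 * (q t * X t + sqrt (1 - (r t)\<^sup>2) * (\<bar>Im (l t) / t\<bar> / (2 * X t)))) \<longlongrightarrow>
      (2 * cmod h + \<bar>2 * Im w - s * K\<bar>) / K) (at_right 0) \<longleftrightarrow>
    ((\<lambda>t. dist_Hinf (disc_aut \<xi> u) (disc_aut (\<xi> + s * t) (u + h * of_real t)) / t) \<longlongrightarrow>
      (2 * cmod h + \<bar>2 * Im w - s * K\<bar>) / K) (at_right 0)"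
  proof (rule tendsto_cong)
    have "((\<lambda>t. cmod (u + h * of_real t)) \<longlongrightarrow> cmod u) (at_right 0)"
      by (auto intro!: tendsto_eq_intros)
    then have ev1: "\<forall>\<^sub>F t in at_right 0. cmod (u + h * of_real t) < 1"
      using u order_tendstoD(2) by blast
    \<comment> \<open>The threshold 1/2 separates the limits 0 and 1 and gives \<rho> < Re \<mu>,
      the case in which the distance has the form above.\<close>
    have ev2: "\<forall>\<^sub>F t in at_right 0. r t < 1/2" "\<forall>\<^sub>F t in at_right 0. 1/2 < X t"
      by (rule order_tendstoD[OF lim_r] order_tendstoD[OF lim_X], simp)+
    have "\<forall>\<^sub>F t in at_right (0::real). 0 < t"
      by (rule eventually_at_right_less)
    with ev1 ev2 show "\<forall>\<^sub>F t in at_right 0.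
        2 * (q t * X t + sqrt (1 - (r t)\<^sup>2) * (\<bar>Im (l t) / t\<bar> / (2 * X t))) =
        dist_Hinf (disc_aut \<xi> u) (disc_aut (\<xi> + s * t) (u + h * of_real t)) / t"
    proof eventually_elim
      case (elim t)
      define \<mu> where "\<mu> = csqrt (l t)"
      have l1: "cmod (l t) = 1"
        unfolding l_def by (rule norm_aut_angle[OF u elim(1)])
      have \<mu>: "cmod \<mu> = 1" "\<mu>\<^sup>2 = l t" "Re \<mu> = X t"
        using l1 by (simp_all add: \<mu>_def X_def)
      have "Im (l t) = 2 * X t * Im \<mu>"
        unfolding \<mu>(2,3)[symmetric] by (simp add: power2_eq_square)
      then have Im: "\<bar>Im \<mu>\<bar> / t = \<bar>Im (l t) / t\<bar> / (2 * X t)"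
        using elim by (simp add: abs_mult)
      have "dist_Hinf (disc_aut \<xi> u) (disc_aut (\<xi> + s * t) (u + h * of_real t)) =
          2 * (r t * X t + sqrt (1 - (r t)\<^sup>2) * \<bar>Im \<mu>\<bar>)"
        using dist_Hinf_lt_2_eq[OF u elim(1) \<mu>(1) \<mu>(2)[unfolded l_def]] elim \<mu>(3) by (simp add: r_def)
      also have "\<dots> / t = 2 * (r t / t * X t + sqrt (1 - (r t)\<^sup>2) * (\<bar>Im \<mu>\<bar> / t))"
        by (simp add: add_divide_distrib)
      also have "r t / t = q t"
        using elim by (simp add: r)
      finally show ?case
        unfolding Im by simp
    qed
  qed
  finally show ?thesis
    by (simp only: K_def w_def)
qed

lemma induced_structure_disc_aut:
  assumes "cmod u < 1"
  shows "induced_structure (disc_aut \<xi> u) (s, h) =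
    (2 * cmod h + \<bar>2 * Im (cnj u * h) - s * (1 - (cmod u)\<^sup>2)\<bar>) / (1 - (cmod u)\<^sup>2)"
proof -
  obtain \<eta> where "disc_coords (disc_aut \<xi> u) = (\<eta>, u)"
    using disc_coords_disc_aut[OF assms] .
  then show ?thesis
    unfolding induced_structure_def
    using tendsto_Lim[OF trivial_limit_at_right_real dist_Hinf_quotient_tendsto[OF assms]] by simp
qed

section \<open>Geodesics\<close>

text \<open>An automorphism \<open>m\<close> takes values near the unit circle, so the parallelogram law
  \<open>|z - m z|\<^sup>2 + |z + m z|\<^sup>2 = 2|z|\<^sup>2 + 2|m z|\<^sup>2\<close> prevents \<open>m\<close> from being a midpoint of the
  identity and its negative, which are at distance \<open>2\<close>.\<close>

lemma not_geodetic_space_Aut_disc: "\<not> geodetic_space Aut_disc dist_Hinf"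
proof
  assume geo: "geodetic_space Aut_disc dist_Hinf"
  have "disc_aut 0 0 \<in> Aut_disc" "disc_aut pi 0 \<in> Aut_disc"
    using disc_aut_in_Aut_disc[of 0] by auto
  then obtain L \<gamma> where L: "0 \<le> L" and \<gamma>: "geodesic L Aut_disc dist_Hinf \<gamma>"
      "\<gamma> 0 = disc_aut 0 0" "\<gamma> L = disc_aut pi 0"
    using geo unfolding geodetic_space_def by blast
  have dist: "dist_Hinf (\<gamma> t1) (\<gamma> t2) = \<bar>t2 - t1\<bar>" if "t1 \<in> {0..L}" "t2 \<in> {0..L}" for t1 t2
    using \<gamma>(1) that by (auto simp: geodesic_def)
  \<comment> \<open>At z = 1 the values are 1 and -1. Hence a geodesic has length 2 and passes its
    midpoint at time 1.\<close>
  have "dist_Hinf (disc_aut 0 0) (disc_aut pi 0) = 2"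
    by (rule dist_Hinf_eq_circle_max[where ?z0.0 = 1]) (auto simp: Moebius_function_def norm_mult)
  then have L2: "L = 2"
    using dist[of 0 L] L \<gamma> by simp
  then have "\<gamma> 1 \<in> Aut_disc"
    using \<gamma>(1) by (auto simp: geodesic_def)
  then obtain \<eta> v where v: "cmod v < 1" and m: "\<gamma> 1 = disc_aut \<eta> v"
    by (rule Aut_disc_cases)
  let ?m = "Moebius_function \<eta> v"
  have le: "cmod (Moebius_function \<xi> u z - Moebius_function \<zeta> w z) \<le> 1"
    if "cmod z < 1" "dist_Hinf (disc_aut \<xi> u) (disc_aut \<zeta> w) = 1" "cmod u < 1" "cmod w < 1" for \<xi> \<zeta> u w z
  proof -
    have "cmod (disc_aut \<xi> u z - disc_aut \<zeta> w z) \<le> 2" if "z \<in> unit_disc" for z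
    proof -
      have "cmod (disc_aut \<xi> u z) < 1" "cmod (disc_aut \<zeta> w z) < 1"
        using that \<open>cmod u < 1\<close> \<open>cmod w < 1\<close> by (simp_all add: disc_aut_def Moebius_function_norm_lt_1)
      then show ?thesis
        using norm_triangle_ineq4[of "disc_aut \<xi> u z" "disc_aut \<zeta> w z"] by linarith
    qed
    then have "bdd_above ((\<lambda>z. cmod (disc_aut \<xi> u z - disc_aut \<zeta> w z)) ` unit_disc)"
      by (rule bdd_aboveI2)
    then have "cmod (disc_aut \<xi> u z - disc_aut \<zeta> w z) \<le> dist_Hinf (disc_aut \<xi> u) (disc_aut \<zeta> w)"
      unfolding dist_Hinf_def using that by (intro cSUP_upper) auto
    then show ?thesis
      using that by (simp add: disc_aut_def)
  qed
  have "(cmod z)\<^sup>2 + (cmod (?m z))\<^sup>2 \<le> 1" if z: "z \<in> unit_disc" for z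
  proof -
    have "cmod (z - ?m z) \<le> 1"
      using le[of z 0 0 \<eta> v] dist[of 0 1] z v L2 \<gamma> m by (simp add: Moebius_function_def)
    moreover have "cmod (z + ?m z) \<le> 1"
      using le[of z \<eta> v pi 0] dist[of 1 2] z v L2 \<gamma> m by (simp add: Moebius_function_def add.commute)
    ultimately have "(cmod (z - ?m z))\<^sup>2 + (cmod (z + ?m z))\<^sup>2 \<le> 1 + 1"
      by (intro add_mono) (simp_all add: power_le_one)
    then show ?thesis
      unfolding cmod_power2 by (simp add: power2_eq_square algebra_simps)
  qed
  then have "unit_disc \<subseteq> {z \<in> cball 0 1. (cmod z)\<^sup>2 + (cmod (?m z))\<^sup>2 \<le> 1}"
    by auto
  then have "closure unit_disc \<subseteq> {z \<in> cball 0 1. (cmod z)\<^sup>2 + (cmod (?m z))\<^sup>2 \<le> 1}"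
    by (rule closure_minimal)
      (rule continuous_on_closed_Collect_le; intro continuous_intros continuous_on_Moebius_function v closed_cball)
  \<comment> \<open>At the boundary point 1 the bound leaves no room for \<open>?m\<close>, whose
    only zero v lies inside the disc.\<close>
  then have "?m 1 = 0"
    by (auto simp: subset_iff dest!: spec[of _ 1])
  then show False
    using v one_minus_cnj_mult_nonzero[OF v, of 1] by (auto simp: Moebius_function_def)
qed

section \<open>Calculus of smooth functions\<close>

lemma frechet_derivative_eqI: "(f has_derivative f') (at x) \<Longrightarrow> frechet_derivative f (at x) = f'"
  using frechet_derivative_at by metis

text \<open>On an open set, equality of the functions passes to their derivatives, so the induction
  on the order goes through.\<close>

lemma Ck_on_cong:
  assumes S: "open S" and "Ck_on k f S" and "\<And>x. x \<in> S \<Longrightarrow> f x = g x"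
  shows "Ck_on k g S"
  using assms(2,3)
proof (induction k arbitrary: f g)
  case 0
  then show ?case
    by (auto cong: continuous_on_cong)
next
  case (Suc k)
  have deriv: "(g has_derivative frechet_derivative f (at x)) (at x)" if "x \<in> S" for x
    using Suc.prems that S frechet_derivative_works
    by (metis Ck_on.simps(2) has_derivative_transform_within_open)
  show ?case
    unfolding Ck_on.simps
  proof (intro conjI ballI allI)
    show "g differentiable at x" if "x \<in> S" for x
      using deriv[OF that] by (auto simp: differentiable_def)
    show "Ck_on k (\<lambda>x. frechet_derivative g (at x) v) S" for v
    proof (rule Suc.IH)
      show "Ck_on k (\<lambda>x. frechet_derivative f (at x) v) S"
        using Suc.prems by simp
    qed (simp add: frechet_derivative_eqI[OF deriv])
  qed
qed

text \<open>Allows any explicit derivative in place of the one chosen by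
  \<open>frechet_derivative\<close>; the closure rules below compute with such formulas.\<close>

lemma Ck_on_SucI:
  assumes "open S" "\<And>x. x \<in> S \<Longrightarrow> (f has_derivative f' x) (at x)" "\<And>v. Ck_on k (\<lambda>x. f' x v) S"
  shows "Ck_on (Suc k) f S"
  unfolding Ck_on.simps
proof (intro conjI ballI allI)
  show "f differentiable at x" if "x \<in> S" for x
    using assms(2)[OF that] by (auto simp: differentiable_def)
  show "Ck_on k (\<lambda>x. frechet_derivative f (at x) v) S" for v
    by (rule Ck_on_cong[OF assms(1,3)]) (simp add: frechet_derivative_eqI[OF assms(2)])
qed

lemma Ck_on_SucE:
  assumes "Ck_on (Suc k) f S"
  obtains f' where "\<And>x. x \<in> S \<Longrightarrow> (f has_derivative f' x) (at x)" "\<And>v. Ck_on k (\<lambda>x. f' x v) S"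
  using assms that[of "\<lambda>x. frechet_derivative f (at x)"] by (simp add: frechet_derivative_works)

lemma Ck_on_Suc_imp: "Ck_on (Suc k) f S \<Longrightarrow> Ck_on k f S"
proof (induction k arbitrary: f)
  case 0
  then show ?case
    by (auto intro!: continuous_at_imp_continuous_on differentiable_imp_continuous_within)
next
  case (Suc k)
  then show ?case
    by (subst Ck_on.simps, subst (asm) (2) Ck_on.simps) auto
qed

lemma Ck_on_const: "open S \<Longrightarrow> Ck_on k (\<lambda>x. c) S"
  by (induction k arbitrary: c) (auto intro!: Ck_on_SucI derivative_eq_intros)

lemma Ck_on_linear:
  assumes S: "open S" and h: "linear h"
  shows "Ck_on k h S"
proof (cases k)
  case (Suc j)
  show ?thesis
    unfolding Suc using S linear_imp_has_derivative[OF h]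
    by (rule Ck_on_SucI) (rule Ck_on_const[OF S])
qed (use h linear_continuous_on in \<open>auto simp: linear_conv_bounded_linear\<close>)

lemma Ck_on_add:
  assumes S: "open S"
  shows "Ck_on k f S \<Longrightarrow> Ck_on k g S \<Longrightarrow> Ck_on k (\<lambda>x. f x + g x) S"
proof (induction k arbitrary: f g)
  case (Suc k)
  obtain f' where f: "\<And>x. x \<in> S \<Longrightarrow> (f has_derivative f' x) (at x)" "\<And>v. Ck_on k (\<lambda>x. f' x v) S"
    using Suc.prems(1) by (rule Ck_on_SucE) blast
  obtain g' where g: "\<And>x. x \<in> S \<Longrightarrow> (g has_derivative g' x) (at x)" "\<And>v. Ck_on k (\<lambda>x. g' x v) S"
    using Suc.prems(2) by (rule Ck_on_SucE) blast
  show ?case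
    by (rule Ck_on_SucI[OF S has_derivative_add]) (rule f g Suc.IH | assumption)+
qed (auto intro: continuous_on_add)

lemma Ck_on_scaleR:
  fixes f :: "'a::euclidean_space \<Rightarrow> real"
  assumes S: "open S"
  shows "Ck_on k f S \<Longrightarrow> Ck_on k g S \<Longrightarrow> Ck_on k (\<lambda>x. f x *\<^sub>R g x) S"
proof (induction k arbitrary: f g)
  case (Suc k)
  obtain f' where f: "\<And>x. x \<in> S \<Longrightarrow> (f has_derivative f' x) (at x)" "\<And>v. Ck_on k (\<lambda>x. f' x v) S"
    using Suc.prems(1) by (rule Ck_on_SucE) blast
  obtain g' where g: "\<And>x. x \<in> S \<Longrightarrow> (g has_derivative g' x) (at x)" "\<And>v. Ck_on k (\<lambda>x. g' x v) S"
    using Suc.prems(2) by (rule Ck_on_SucE) blast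
  show ?case
    by (rule Ck_on_SucI[OF S has_derivative_scaleR])
      (rule f g Suc.IH Ck_on_add[OF S] Ck_on_Suc_imp[OF Suc.prems(1)] Ck_on_Suc_imp[OF Suc.prems(2)] | assumption)+
qed (auto intro: continuous_on_scaleR)

lemma Ck_on_mult:
  fixes f g :: "'a::euclidean_space \<Rightarrow> real"
  shows "open S \<Longrightarrow> Ck_on k f S \<Longrightarrow> Ck_on k g S \<Longrightarrow> Ck_on k (\<lambda>x. f x * g x) S"
  using Ck_on_scaleR[of S k f g] by simp

lemma Ck_on_inverse:
  fixes f :: "'a::euclidean_space \<Rightarrow> real"
  assumes S: "open S" and nz: "\<And>x. x \<in> S \<Longrightarrow> f x \<noteq> 0"
  shows "Ck_on k f S \<Longrightarrow> Ck_on k (\<lambda>x. inverse (f x)) S"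
proof (induction k)
  case (Suc k)
  obtain f' where D: "\<And>x. x \<in> S \<Longrightarrow> (f has_derivative f' x) (at x)" "\<And>v. Ck_on k (\<lambda>x. f' x v) S"
    using Suc.prems by (rule Ck_on_SucE) blast
  show ?case
  proof (rule Ck_on_SucI[OF S])
    \<comment> \<open>The negative sign is written as a factor -1, so that the derivative is built
      from constants and products only.\<close>
    show "((\<lambda>x. inverse (f x)) has_derivative (\<lambda>v. -1 * (inverse (f x) * (f' x v * inverse (f x))))) (at x)"
      if "x \<in> S" for x
      using Deriv.has_derivative_inverse[OF nz[OF that] D(1)[OF that]] by (simp add: mult.assoc)
    show "Ck_on k (\<lambda>x. - 1 * (inverse (f x) * (f' x v * inverse (f x)))) S" for v
      by (intro Ck_on_mult S Ck_on_const D Suc.IH Ck_on_Suc_imp[OF Suc.prems])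
  qed
qed (use nz in \<open>auto intro!: continuous_on_inverse\<close>)

lemma Ck_on_sqrt:
  fixes f :: "'a::euclidean_space \<Rightarrow> real"
  assumes S: "open S" and pos: "\<And>x. x \<in> S \<Longrightarrow> f x > 0"
  shows "Ck_on k f S \<Longrightarrow> Ck_on k (\<lambda>x. sqrt (f x)) S"
proof (induction k)
  case (Suc k)
  obtain f' where D: "\<And>x. x \<in> S \<Longrightarrow> (f has_derivative f' x) (at x)" "\<And>v. Ck_on k (\<lambda>x. f' x v) S"
    using Suc.prems by (rule Ck_on_SucE) blast
  show ?case
  proof (rule Ck_on_SucI[OF S])
    show "((\<lambda>x. sqrt (f x)) has_derivative (\<lambda>v. inverse (2 * sqrt (f x)) * f' x v)) (at x)"
      if "x \<in> S" for x
      using pos[OF that] D(1)[OF that] by (auto intro!: derivative_eq_intros simp: field_simps)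
    show "Ck_on k (\<lambda>x. inverse (2 * sqrt (f x)) * f' x v) S" for v
      by (intro Ck_on_mult Ck_on_inverse S Ck_on_const D Suc.IH Ck_on_Suc_imp[OF Suc.prems])
        (use pos in force)
  qed
qed (auto intro!: continuous_on_real_sqrt)

lemma smooth_on_cong:
  "open S \<Longrightarrow> smooth_on f S \<Longrightarrow> (\<And>x. x \<in> S \<Longrightarrow> f x = g x) \<Longrightarrow> smooth_on g S"
  unfolding smooth_on_def using Ck_on_cong by blast

lemmas Ck_on_intros =
  Ck_on_const Ck_on_add Ck_on_scaleR Ck_on_mult Ck_on_inverse Ck_on_sqrt

section \<open>The Finsler structure\<close>

text \<open>Half the Hessian of F^2 is dF(v)^2 + F times the Hessian of F. Only the norm contributes
  to the latter: its second derivative is the squared length of the part of \<open>snd v\<close>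
  orthogonal to \<open>snd y\<close>, divided by the norm of \<open>snd y\<close>.\<close>

lemma fundamental_tensor_norm_plus_linear:
  fixes L :: "'a::euclidean_space \<times> 'b::euclidean_space \<Rightarrow> real"
  assumes L: "bounded_linear L" and U: "open U" "y \<in> U"
    and F: "\<And>y. y \<in> U \<Longrightarrow> snd y \<noteq> 0 \<and> F y = a * norm (snd y) + L y"
  defines "k \<equiv> \<lambda>v. snd v \<bullet> sgn (snd y)"
  shows "frechet_derivative (\<lambda>y'. frechet_derivative (\<lambda>y''. (F y'')\<^sup>2) (at y') v) (at y) v / 2 =
    (a * k v + L v)\<^sup>2 + F y * a * (norm (snd v - k v *\<^sub>R sgn (snd y)))\<^sup>2 / norm (snd y)"
proof -
  note [derivative_intros] = bounded_linear.has_derivative[OF L]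
  \<comment> \<open>The derivative of F^2 in direction \<open>v\<close>, as a function of the base
    point, to be differentiated once more.\<close>
  define P where "P y' = 2 * (a * norm (snd y') + L y') * (a * ((snd v \<bullet> snd y') * inverse (norm (snd y'))) + L v)"
    for y'
  have deriv_norm [derivative_intros]:
    "((\<lambda>y. norm (snd y)) has_derivative (\<lambda>v. snd v \<bullet> sgn (snd y'))) (at y')" if "y' \<in> U" for y'
    using has_derivative_compose[OF has_derivative_snd[OF has_derivative_ident] has_derivative_norm] F[OF that]
    by blast
  have deriv_F: "((\<lambda>y. a * norm (snd y) + L y) has_derivative (\<lambda>v. a * (snd v \<bullet> sgn (snd y')) + L v)) (at y')"
    if "y' \<in> U" for y'
    using that by (auto intro!: derivative_eq_intros)
  have "frechet_derivative (\<lambda>y''. (F y'')\<^sup>2) (at y') v = P y'" if y': "y' \<in> U" for y'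
  proof -
    have "((\<lambda>y. (a * norm (snd y) + L y)\<^sup>2) has_derivative
        (\<lambda>v. 2 * (a * norm (snd y') + L y') * (a * (snd v \<bullet> sgn (snd y')) + L v))) (at y')"
      by (rule has_derivative_eq_rhs[OF has_derivative_power[OF deriv_F[OF y']]])
        (simp add: fun_eq_iff algebra_simps)
    then have "((\<lambda>y. (F y)\<^sup>2) has_derivative
        (\<lambda>v. 2 * (a * norm (snd y') + L y') * (a * (snd v \<bullet> sgn (snd y')) + L v))) (at y')"
      by (rule has_derivative_transform_within_open[OF _ U(1) y']) (simp add: F)
    then show ?thesis
      by (simp add: frechet_derivative_eqI P_def sgn_div_norm mult.commute)
  qed
  moreover
  define q where "q = snd v - k v *\<^sub>R sgn (snd y)"
  define N where "N = norm (snd y)"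
  have N: "N > 0"
    using F[OF U(2)] by (simp add: N_def)
  have k: "k v = (snd v \<bullet> snd y) / N"
    by (simp add: k_def sgn_div_norm N_def field_simps)
  have q: "(norm q)\<^sup>2 = snd v \<bullet> snd v - (k v)\<^sup>2"
  proof -
    have "sgn (snd y) \<bullet> sgn (snd y) = 1"
      using F[OF U(2)] by (simp add: norm_sgn flip: power2_norm_eq_inner)
    moreover have "sgn (snd y) \<bullet> snd v = k v"
      by (simp add: k_def inner_commute)
    moreover have "snd v \<bullet> sgn (snd y) = k v"
      by (simp add: k_def)
    ultimately show ?thesis
      unfolding power2_norm_eq_inner by (simp add: q_def inner_diff_left inner_diff_right power2_eq_square)
  qed
  have "(P has_derivative (\<lambda>w. 2 * (a * k w + L w) * (a * ((snd v \<bullet> snd y) * inverse N) + L v)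
      + 2 * (a * N + L y) * (a * ((snd v \<bullet> snd w) * inverse N
        - (snd v \<bullet> snd y) * (inverse N * k w * inverse N))))) (at y)"
    using U(2) F[OF U(2)] unfolding P_def N_def k_def
    by (auto intro!: derivative_eq_intros simp: algebra_simps)
  ultimately have "((\<lambda>y'. frechet_derivative (\<lambda>y''. (F y'')\<^sup>2) (at y') v) has_derivative
      (\<lambda>w. 2 * (a * k w + L w) * (a * ((snd v \<bullet> snd y) * inverse N) + L v)
      + 2 * (a * N + L y) * (a * ((snd v \<bullet> snd w) * inverse N
        - (snd v \<bullet> snd y) * (inverse N * k w * inverse N))))) (at y)"
    by (metis (no_types, lifting) has_derivative_transform_within_open[OF _ U])
  then show ?thesis
    using N F[OF U(2)] unfolding q_def[symmetric] N_def[symmetric] q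
    by (simp add: frechet_derivative_eqI k field_simps power2_eq_square)
qed

text \<open>Divided by -(1 - |u|^2), this is the rate of change of the argument of \<lambda> along
  the tangent vector.\<close>

definition disc_form :: "complex \<Rightarrow> tangent \<Rightarrow> real" where
  "disc_form u y = 2 * Im (cnj u * snd y) - fst y * (1 - (cmod u)\<^sup>2)"

lemma bounded_linear_disc_form: "bounded_linear (disc_form u)"
  unfolding linear_conv_bounded_linear[symmetric] disc_form_def
  by (rule linearI) (simp_all add: algebra_simps)

lemma disc_factor_pos: "cmod u < 1 \<Longrightarrow> 0 < 1 - (cmod u)\<^sup>2"
  by (simp add: abs_square_less_1)

lemma induced_structure_eq:
  "cmod u < 1 \<Longrightarrow>
    induced_structure (disc_aut \<xi> u) y = (2 * cmod (snd y) + \<bar>disc_form u y\<bar>) / (1 - (cmod u)\<^sup>2)"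
  by (cases y) (simp add: induced_structure_disc_aut disc_form_def)

text \<open>The degenerate direction \<open>n\<close> moves \<open>h\<close> radially and compensates the growth of \<open>2|h|\<close> by the
  decrease of \<^term>\<open>\<bar>disc_form u y\<bar>\<close>.\<close>

lemma fundamental_tensor_pos:
  assumes u: "cmod u < 1" and y: "snd y \<noteq> 0" "disc_form u y \<noteq> 0"
  shows "\<exists>n. \<forall>v. v \<notin> span {n} \<longrightarrow> fundamental_tensor induced_structure (disc_aut \<xi> u) y v v > 0"
proof -
  define K where "K = 1 - (cmod u)\<^sup>2"
  have K: "K > 0"
    using disc_factor_pos[OF u] by (simp add: K_def)
  \<comment> \<open>With the sign frozen on the open set \<open>U\<close>, the absolute value is
    linear there and the tensor formula applies.\<close>
  define \<sigma> where "\<sigma> = sgn (disc_form u y)"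
  have \<sigma>: "\<sigma> * \<sigma> = 1"
    using y by (simp add: \<sigma>_def sgn_if)
  define U where "U = {y. snd y \<noteq> 0 \<and> 0 < \<sigma> * disc_form u y}"
  define L where "L y = \<sigma> / K * disc_form u y" for y
  note form = bounded_linear_disc_form[of u]
  have L: "bounded_linear L"
    unfolding L_def by (intro bounded_linear_const_mult form)
  have "open U"
    unfolding U_def
    by (intro open_Collect_conj open_Collect_neq open_Collect_less continuous_intros
        linear_continuous_on[OF form])
  moreover have "y \<in> U"
    using y by (simp add: U_def \<sigma>_def sgn_if)
  moreover have F: "snd y \<noteq> 0 \<and> induced_structure (disc_aut \<xi> u) y = 2 / K * cmod (snd y) + L y"
    if "y \<in> U" for y
  proof -
    have "\<bar>disc_form u y\<bar> = \<sigma> * disc_form u y"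
      using that \<sigma> by (auto simp: U_def \<sigma>_def sgn_if split: if_splits)
    then show ?thesis
      using that u by (simp add: induced_structure_eq L_def U_def K_def add_divide_distrib)
  qed
  ultimately have tensor: "fundamental_tensor induced_structure (disc_aut \<xi> u) y v v =
      (2 / K * (snd v \<bullet> sgn (snd y)) + L v)\<^sup>2 + induced_structure (disc_aut \<xi> u) y * (2 / K) *
        (norm (snd v - (snd v \<bullet> sgn (snd y)) *\<^sub>R sgn (snd y)))\<^sup>2 / norm (snd y)" for v
    unfolding fundamental_tensor_def by (rule fundamental_tensor_norm_plus_linear[OF L])
  have Fy: "induced_structure (disc_aut \<xi> u) y > 0"
    using disc_factor_pos[OF u] y u by (simp add: induced_structure_eq add_pos_nonneg)
  \<comment> \<open>The first component is solved from
    \<open>disc_form u n = - 2 * \<sigma>\<close>.\<close>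
  define n :: tangent where "n = ((2 * Im (cnj u * sgn (snd y)) + 2 * \<sigma>) / K, sgn (snd y))"
  have "disc_form u n = - 2 * \<sigma>"
    using K by (simp add: disc_form_def n_def K_def[symmetric])
  then have Ln: "L n = - 2 / K"
    using \<sigma> by (simp add: L_def)
  have "fundamental_tensor induced_structure (disc_aut \<xi> u) y v v > 0" if v: "v \<notin> span {n}" for v
  proof (rule ccontr)
    define k where "k = snd v \<bullet> sgn (snd y)"
    define A where "A = (2 / K * k + L v)\<^sup>2"
    define B where "B = induced_structure (disc_aut \<xi> u) y * (2 / K) *
      (norm (snd v - k *\<^sub>R sgn (snd y)))\<^sup>2 / norm (snd y)"
    assume "\<not> fundamental_tensor induced_structure (disc_aut \<xi> u) y v v > 0"
    then have "A + B \<le> 0"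
      unfolding tensor by (simp add: A_def B_def k_def)
    moreover have "A \<ge> 0" "B \<ge> 0"
      using Fy K by (simp_all add: A_def B_def)
    \<comment> \<open>Both squares vanish: B = 0 makes \<open>snd v\<close> radial, and A = 0 then
      fixes \<open>fst v\<close>, which leaves only multiples of \<open>n\<close>.\<close>
    ultimately have "A = 0" "B = 0"
      by linarith+
    then have 2: "2 / K * k + L v = 0"
      unfolding A_def zero_eq_power2 by blast
    have "norm (snd v - k *\<^sub>R sgn (snd y)) = 0"
      using \<open>B = 0\<close> Fy K y(1) unfolding B_def
      by (simp only: mult_eq_0_iff divide_eq_0_iff zero_eq_power2 norm_eq_zero) simp
    then have 1: "snd v = k *\<^sub>R sgn (snd y)"
      unfolding norm_eq_zero right_minus_eq .
    define d where "d = v - k *\<^sub>R n"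
    have d: "snd d = 0"
      using 1 by (simp add: d_def n_def)
    have "L d = L v - k * L n"
      unfolding d_def using bounded_linear.linear[OF L] by (simp add: linear_diff linear_cmul)
    also have "\<dots> = 0"
      unfolding Ln using 2 K by (simp add: field_simps)
    finally have "L d = 0" .
    moreover have "L d = - (\<sigma> * fst d)"
      using d K by (simp add: L_def disc_form_def flip: K_def)
    moreover have "\<sigma> \<noteq> 0"
      using y by (simp add: \<sigma>_def sgn_if)
    ultimately have "fst d = 0"
      by simp
    with d have "d = 0"
      by (simp add: prod_eq_iff)
    then have "v = k *\<^sub>R n"
      by (simp add: d_def)
    then show False
      using v by (simp add: span_base span_scale)
  qed
  then show ?thesis
    by blast
qed

section \<open>The two exceptional sub-bundles\<close>

lemma snd_disc_coords: "cmod u < 1 \<Longrightarrow> snd (disc_coords (disc_aut \<xi> u)) = u"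
  using disc_coords_disc_aut[of u \<xi>] by force

text \<open>The line bundle h = 0, where |h| is singular.\<close>

definition rotation_bundle :: "(complex \<Rightarrow> complex) \<Rightarrow> tangent set" where
  "rotation_bundle \<phi> = span {(1, 0)}"

text \<open>The kernel of \<open>disc_form u\<close>, as the graph of s = 2 Im(cnj u h) / (1 -
  |u|^2) over the real basis 1, i of the h-plane.\<close>

definition kernel_bundle :: "(complex \<Rightarrow> complex) \<Rightarrow> tangent set" where
  "kernel_bundle \<phi> = (let u = snd (disc_coords \<phi>) in
     span {(- 2 * Im u / (1 - (cmod u)\<^sup>2), 1), (2 * Re u / (1 - (cmod u)\<^sup>2), \<i>)})"

lemma mem_rotation_bundle: "y \<in> rotation_bundle \<phi> \<longleftrightarrow> snd y = 0"
  by (cases y) (auto simp: rotation_bundle_def span_singleton image_iff)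

lemma mem_span_graph:
  "y \<in> span {(p, 1), (q, \<i>)} \<longleftrightarrow> fst y = p * Re (snd y) + q * Im (snd y)" for y :: tangent
  by (simp add: span_insert span_singleton image_iff prod_eq_iff complex_eq_iff)
    (auto simp: algebra_simps)

lemma mem_kernel_bundle:
  assumes "cmod u < 1"
  shows "y \<in> kernel_bundle (disc_aut \<xi> u) \<longleftrightarrow> disc_form u y = 0"
proof -
  define K where "K = 1 - (cmod u)\<^sup>2"
  have "K > 0"
    using disc_factor_pos[OF assms] by (simp add: K_def)
  then show ?thesis
    using assms unfolding kernel_bundle_def disc_form_def K_def[symmetric]
    by (auto simp: snd_disc_coords mem_span_graph K_def[symmetric] field_simps)
qed

lemma open_disc_coords: "open (UNIV \<times> unit_disc :: (real \<times> complex) set)"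
  by (intro open_Times) auto

lemma proper_subbundle_rotation: "proper_subbundle rotation_bundle"
  unfolding proper_subbundle_def
proof (intro exI[of _ 1] conjI ballI)
  have "independent {(1, 0) :: tangent}"
    by (simp add: prod_eq_iff)
  then show "dim (rotation_bundle \<phi>) = 1" for \<phi>
    by (simp add: rotation_bundle_def dim_eq_card_independent)
  show "\<exists>U b. open U \<and> p \<in> U \<and> U \<subseteq> UNIV \<times> unit_disc \<and>
      (\<forall>i<1. smooth_on (b i :: real \<times> complex \<Rightarrow> tangent) U) \<and>
      (\<forall>(\<xi>, u)\<in>U. rotation_bundle (disc_aut \<xi> u) = span ((\<lambda>i::nat. b i (\<xi>, u)) ` {..<1}))"
    if "p \<in> UNIV \<times> unit_disc" for p
    using that open_disc_coords
    by (intro exI[of _ "UNIV \<times> unit_disc"] exI[of _ "\<lambda>_ _. (1, 0)"])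
      (auto simp: smooth_on_def rotation_bundle_def lessThan_Suc intro!: Ck_on_const)
qed (auto simp: rotation_bundle_def)

lemma proper_subbundle_kernel: "proper_subbundle kernel_bundle"
  unfolding proper_subbundle_def
proof (intro exI[of _ 2] conjI ballI)
  have "independent {(p, 1), (q, \<i>) :: tangent}" for p q
    by (auto simp: independent_insert span_singleton prod_eq_iff complex_eq_iff)
  then show "dim (kernel_bundle \<phi>) = 2" for \<phi>
    by (simp add: kernel_bundle_def Let_def dim_eq_card_independent)
  \<comment> \<open>The two spanning fields, written with real sums, products and inverses so that
    \<open>Ck_on_intros\<close> applies; they are defined on the whole parameter space.\<close>
  define b where "b i p = (((if i = 0 then (-2) else 0) * Im (snd p) + (if i = 0 then 0 else 2) * Re (snd p)) *
      inverse (1 + (-1) * (Re (snd p) * Re (snd p) + Im (snd p) * Im (snd p)))) *\<^sub>R (1, 0)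
      + ((0, if i = 0 then 1 else \<i>) :: tangent)" for i :: nat and p :: "real \<times> complex"
  have cmod2: "Re u * Re u + Im u * Im u = (cmod u)\<^sup>2" for u
    unfolding cmod_power2 by (simp add: power2_eq_square)
  have "Ck_on k (b i) (UNIV \<times> unit_disc)" for i k
  proof -
    have lin: "Ck_on k (\<lambda>p :: real \<times> complex. Re (snd p)) (UNIV \<times> unit_disc)"
      "Ck_on k (\<lambda>p :: real \<times> complex. Im (snd p)) (UNIV \<times> unit_disc)"
      by (auto intro!: Ck_on_linear[OF open_disc_coords] linearI)
    have nz: "1 + (-1) * (Re (snd p) * Re (snd p) + Im (snd p) * Im (snd p)) \<noteq> 0"
      if "p \<in> UNIV \<times> unit_disc" for p :: "real \<times> complex"
      unfolding cmod2 using that disc_factor_pos[of "snd p"] by auto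
    show ?thesis
      unfolding b_def
      by (intro Ck_on_intros open_disc_coords lin nz)
  qed
  moreover have "kernel_bundle (disc_aut \<xi> u) = span ((\<lambda>i. b i (\<xi>, u)) ` {..<2})" if "cmod u < 1" for \<xi> u
    using that by (simp add: kernel_bundle_def snd_disc_coords b_def cmod2 numeral_2_eq_2 lessThan_Suc
        insert_commute divide_inverse)
  ultimately show "\<exists>U b. open U \<and> p \<in> U \<and> U \<subseteq> UNIV \<times> unit_disc \<and>
      (\<forall>i<2. smooth_on (b i :: real \<times> complex \<Rightarrow> tangent) U) \<and>
      (\<forall>(\<xi>, u)\<in>U. kernel_bundle (disc_aut \<xi> u) = span ((\<lambda>i::nat. b i (\<xi>, u)) ` {..<2}))"
    if "p \<in> UNIV \<times> unit_disc" for p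
    using that open_disc_coords
    by (intro exI[of _ "UNIV \<times> unit_disc"] exI[of _ b]) (auto simp: smooth_on_def)
qed (auto simp: kernel_bundle_def Let_def)

section \<open>Reversibility, non-Riemannian character and almost regularity\<close>

lemma reversible_induced_structure: "reversible induced_structure"
  by (auto simp: reversible_def induced_structure_eq disc_form_def elim!: Aut_disc_cases)

text \<open>A Riemannian structure satisfies the parallelogram law in each tangent space; 2|h| + |s|
  at the identity violates it.\<close>

lemma not_riemannian_induced_structure: "\<not> riemannian induced_structure"
proof
  assume "riemannian induced_structure"
  then obtain g where g: "riemannian_metric g"
      "\<And>\<phi> y. \<phi> \<in> Aut_disc \<Longrightarrow> induced_structure \<phi> y = sqrt (g \<phi> y y)"
    unfolding riemannian_def by blast
  define G where "G = g (disc_aut 0 0)"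
  have aut: "disc_aut 0 0 \<in> Aut_disc"
    by (simp add: disc_aut_in_Aut_disc)
  then have G: "bilinear G" "\<And>v. v \<noteq> 0 \<Longrightarrow> G v v > 0"
    using g(1) by (auto simp: riemannian_metric_def G_def)
  have sq: "G (s, h) (s, h) = (2 * cmod h + \<bar>s\<bar>)\<^sup>2" if "(s, h) \<noteq> 0" for s h
  proof -
    have "sqrt (G (s, h) (s, h)) = 2 * cmod h + \<bar>s\<bar>"
      using g(2)[OF aut, of "(s, h)"] by (simp add: G_def induced_structure_disc_aut)
    then show ?thesis
      using G(2)[OF that] real_sqrt_pow2[of "G (s, h) (s, h)"] by simp
  qed
  have "G (v + w) (v + w) + G (v - w) (v - w) = 2 * G v v + 2 * G w w" for v w
    using G(1) by (simp add: bilinear_ladd bilinear_radd bilinear_lsub bilinear_rsub)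
  \<comment> \<open>The left side is 9 + 9, the right side 2 + 8.\<close>
  from this[of "(1, 0)" "(0, 1)"] show False
    by (simp add: sq zero_prod_def)
qed

lemma almost_regular_induced_structure: "almost_regular_weak_Finsler induced_structure"
  unfolding almost_regular_weak_Finsler_def
proof (intro conjI exI[of _ "{rotation_bundle, kernel_bundle}"] ballI allI impI)
  show "proper_subbundle E" if "E \<in> {rotation_bundle, kernel_bundle}" for E
    using that proper_subbundle_rotation proper_subbundle_kernel by auto
  show "\<exists>n. \<forall>v. v \<notin> span {n} \<longrightarrow> fundamental_tensor induced_structure \<phi> y v v > 0"
    if \<phi>: "\<phi> \<in> Aut_disc" and y: "\<forall>E\<in>{rotation_bundle, kernel_bundle}. y \<notin> E \<phi>" for \<phi> y
  proof -
    obtain \<xi> u where "cmod u < 1" "\<phi> = disc_aut \<xi> u"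
      using \<phi> by (rule Aut_disc_cases)
    then show ?thesis
      using y fundamental_tensor_pos by (simp add: mem_rotation_bundle mem_kernel_bundle)
  qed
  show "induced_structure \<phi> (t *\<^sub>R y) = t * induced_structure \<phi> y" if \<phi>: "\<phi> \<in> Aut_disc" and t: "0 < t" for \<phi> t y
  proof -
    obtain \<xi> u where u: "cmod u < 1" "\<phi> = disc_aut \<xi> u"
      using \<phi> by (rule Aut_disc_cases)
    have "disc_form u (t *\<^sub>R y) = t * disc_form u y"
      using linear_cmul[OF bounded_linear.linear[OF bounded_linear_disc_form]] by simp
    then show ?thesis
      using u t by (simp add: induced_structure_eq abs_mult algebra_simps)
  qed
  show "0 < induced_structure \<phi> y" if \<phi>: "\<phi> \<in> Aut_disc" and "y \<noteq> 0" for \<phi> y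
  proof -
    obtain \<xi> u where u: "cmod u < 1" "\<phi> = disc_aut \<xi> u"
      using \<phi> by (rule Aut_disc_cases)
    have "disc_form u y \<noteq> 0" if "snd y = 0"
      using that disc_factor_pos[OF u(1)] \<open>y \<noteq> 0\<close> by (simp add: disc_form_def prod_eq_iff)
    then have "0 < 2 * cmod (snd y) + \<bar>disc_form u y\<bar>"
      by (cases "snd y = 0") (auto intro: add_pos_nonneg)
    then show ?thesis
      using u disc_factor_pos[OF u(1)] by (simp add: induced_structure_eq)
  qed
  show "induced_structure \<phi> (y + y') \<le> induced_structure \<phi> y + induced_structure \<phi> y'"
    if \<phi>: "\<phi> \<in> Aut_disc" for \<phi> y y'
  proof -
    obtain \<xi> u where u: "cmod u < 1" "\<phi> = disc_aut \<xi> u"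
      using \<phi> by (rule Aut_disc_cases)
    have "disc_form u (y + y') = disc_form u y + disc_form u y'"
      using linear_add[OF bounded_linear.linear[OF bounded_linear_disc_form]] by simp
    then have "2 * cmod (snd (y + y')) + \<bar>disc_form u (y + y')\<bar> \<le>
        (2 * cmod (snd y) + \<bar>disc_form u y\<bar>) + (2 * cmod (snd y') + \<bar>disc_form u y'\<bar>)"
      using norm_triangle_ineq[of "snd y" "snd y'"] by simp
    then show ?thesis
      using u disc_factor_pos[OF u(1)]
      by (simp add: induced_structure_eq divide_right_mono flip: add_divide_distrib)
  qed
  \<comment> \<open>The complement of the two bundles in coordinates, where neither |h| nor the
    absolute value of \<open>disc_form\<close> vanishes.\<close>
  define S where "S = {p :: (real \<times> complex) \<times> tangent.
    cmod (snd (fst p)) < 1 \<and> snd (snd p) \<noteq> 0 \<and> disc_form (snd (fst p)) (snd p) \<noteq> 0}"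
  have S_eq: "{((\<xi>, u), y). u \<in> unit_disc \<and> (\<forall>E\<in>{rotation_bundle, kernel_bundle}. y \<notin> E (disc_aut \<xi> u))} = S"
    by (auto simp: S_def mem_rotation_bundle mem_kernel_bundle)
  have S: "open S"
    unfolding S_def disc_form_def
    by (intro open_Collect_conj open_Collect_neq open_Collect_less continuous_intros)
  show "smooth_on (\<lambda>((\<xi>, u), y). induced_structure (disc_aut \<xi> u) y)
      {((\<xi>, u), y). u \<in> unit_disc \<and> (\<forall>E\<in>{rotation_bundle, kernel_bundle}. y \<notin> E (disc_aut \<xi> u))}"
    unfolding S_eq
  proof (rule smooth_on_cong[OF S])
    define Z where "Z p = Re (snd (fst p)) * Re (snd (fst p)) + Im (snd (fst p)) * Im (snd (fst p))"
      for p :: "(real \<times> complex) \<times> tangent"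
    define N where "N p = Re (snd (snd p)) * Re (snd (snd p)) + Im (snd (snd p)) * Im (snd (snd p))"
      for p :: "(real \<times> complex) \<times> tangent"
    define W where "W p = 2 * (Re (snd (fst p)) * Im (snd (snd p)) + (-1) * (Im (snd (fst p)) * Re (snd (snd p))))
        + (-1) * (fst (snd p) * (1 + (-1) * Z p))"
      for p :: "(real \<times> complex) \<times> tangent"
    have Z: "Z p = (cmod (snd (fst p)))\<^sup>2" and N: "N p = (cmod (snd (snd p)))\<^sup>2" for p
      unfolding cmod_power2 by (simp_all add: Z_def N_def power2_eq_square)
    have W: "W p = disc_form (snd (fst p)) (snd p)" for p
      by (simp add: W_def Z disc_form_def)
    \<comment> \<open>The modulus and the absolute value become square roots of polynomial
      expressions that are positive on \<open>S\<close>, hence smooth.\<close>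
    show "(2 * sqrt (N p) + sqrt (W p * W p)) * inverse (1 + (-1) * Z p) =
        (case p of (a, y) \<Rightarrow> (case a of (\<xi>, u) \<Rightarrow> \<lambda>y. induced_structure (disc_aut \<xi> u) y) y)"
      if "p \<in> S" for p
      using that by (cases p; cases "fst p") (auto simp: S_def Z N W induced_structure_eq divide_inverse)
    have lin: "Ck_on k (\<lambda>p. Re (snd (fst p))) S" "Ck_on k (\<lambda>p. Im (snd (fst p))) S"
       "Ck_on k (\<lambda>p. Re (snd (snd p))) S" "Ck_on k (\<lambda>p. Im (snd (snd p))) S"
       "Ck_on k (\<lambda>p. fst (snd p)) S" for k
      by (auto intro!: Ck_on_linear[OF S] linearI)
    have CZ: "Ck_on k Z S" and CN: "Ck_on k N S" for k
      unfolding Z_def N_def by (intro Ck_on_intros S lin)+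
    have CW: "Ck_on k W S" for k
      unfolding W_def by (intro Ck_on_intros S lin CZ)
    have nz: "1 + (-1) * Z p \<noteq> 0" "N p > 0" "W p * W p > 0" if "p \<in> S" for p
      using that disc_factor_pos[of "snd (fst p)"] by (auto simp: S_def Z N W zero_less_mult_iff)
    show "smooth_on (\<lambda>p. (2 * sqrt (N p) + sqrt (W p * W p)) * inverse (1 + (-1) * Z p)) S"
      unfolding smooth_on_def by (intro allI Ck_on_intros S CZ CN CW nz)
  qed
qed simp_all

theorem mainTheorem1:
  shows "(\<forall>(\<xi>::real) (\<eta>::real). \<forall>u\<in>unit_disc. \<forall>v\<in>unit_disc.
            let l = exp (\<i> * of_real (\<eta> - \<xi>)) * ((1 - cnj u * v) / (1 - u * cnj v));
                r = pseudo_dist u v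
            in (cmod (l + 1) \<le> 2 * r \<longrightarrow> dist_Hinf (disc_aut \<xi> u) (disc_aut \<eta> v) = 2) \<and>
               (cmod (l + 1) > 2 * r \<longrightarrow>
                  dist_Hinf (disc_aut \<xi> u) (disc_aut \<eta> v) =
                    cmod ((1 - 2 * of_real (r\<^sup>2) - 2 * \<i> * of_real r * of_real (sqrt (1 - r\<^sup>2)))
                          - (of_real (Re l) + \<i> * of_real \<bar>Im l\<bar>)))) \<and>
         (\<forall>(\<xi>::real). \<forall>u\<in>unit_disc. \<forall>(s::real) (h::complex).
            ((\<lambda>t. dist_Hinf (disc_aut \<xi> u) (disc_aut (\<xi> + s * t) (u + h * of_real t)) / t)
               \<longlongrightarrow> induced_structure (disc_aut \<xi> u) (s, h)) (at_right 0) \<and>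
            induced_structure (disc_aut \<xi> u) (s, h) =
              (2 * cmod h + \<bar>2 * Im (cnj u * h) - s * (1 - (cmod u)\<^sup>2)\<bar>) / (1 - (cmod u)\<^sup>2)) \<and>
         almost_regular_weak_Finsler induced_structure \<and>
         reversible induced_structure \<and>
         \<not> riemannian induced_structure \<and>
         \<not> geodetic_space Aut_disc dist_Hinf"
proof -
  have "let l = aut_angle \<xi> \<eta> u v; r = pseudo_dist u v
      in (cmod (l + 1) \<le> 2 * r \<longrightarrow> dist_Hinf (disc_aut \<xi> u) (disc_aut \<eta> v) = 2) \<and>
         (cmod (l + 1) > 2 * r \<longrightarrow>
            dist_Hinf (disc_aut \<xi> u) (disc_aut \<eta> v) =
              cmod ((1 - 2 * of_real (r\<^sup>2) - 2 * \<i> * of_real r * of_real (sqrt (1 - r\<^sup>2)))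
                    - (of_real (Re l) + \<i> * of_real \<bar>Im l\<bar>)))"
    if "u \<in> unit_disc" "v \<in> unit_disc" for \<xi> \<eta> u v
    unfolding Let_def using that by (intro conjI impI dist_Hinf_formula) (simp_all only: mem_ball_0)
  moreover have "((\<lambda>t. dist_Hinf (disc_aut \<xi> u) (disc_aut (\<xi> + s * t) (u + h * of_real t)) / t)
         \<longlongrightarrow> induced_structure (disc_aut \<xi> u) (s, h)) (at_right 0) \<and>
      induced_structure (disc_aut \<xi> u) (s, h) =
        (2 * cmod h + \<bar>2 * Im (cnj u * h) - s * (1 - (cmod u)\<^sup>2)\<bar>) / (1 - (cmod u)\<^sup>2)"
    if "u \<in> unit_disc" for \<xi> u s h
    using that dist_Hinf_quotient_tendsto induced_structure_disc_aut by simp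
  ultimately show ?thesis
    using almost_regular_induced_structure reversible_induced_structure
      not_riemannian_induced_structure not_geodetic_space_Aut_disc
    by blast
qed

end
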